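(* Let $m\geq 1$, let $\mathcal F$ be a family of maps from the round unit sphere $S^m\subset\mathbb{R}^{m+1}$ to $\mathbb{C}$, and let $\lambda,\mu\in\mathbb{C}$. The following are equivalent: (i) $\mathcal F$ is a $(\lambda,\mu)$-eigenfamily on $S^m$. (ii) There is a $(0,0)$-eigenfamily $\widetilde{\mathcal F}$ of homogeneous polynomials from $\mathbb{R}^{m+1}$ to $\mathbb{C}$, all of the same degree $d$, so that the map $\widetilde{\mathcal F}\to\mathcal F$, $F\mapsto F|_{S^m}$, is a well defined bijection and $\lambda=-d(d+m-1)$, $\mu=-d^2$.
   Context: For a Riemannian manifold $(M,g)$, $\Delta=\operatorname{div}\nabla$ denotes the Laplace–Beltrami operator (so that on $\mathbb{R}^n$ it is $\sum_j\partial_j^2$), extended complex linearly to $\mathbb{C}$-valued functions. For smooth $\varphi:M\to\mathbb{C}$, $\nabla\varphi=\nabla\operatorname{Re}\varphi+i\nabla\operatorname{Im}\varphi$ is a section of $TM\otimes\mathbb{C}$, and $g_{\mathbb{C}}$ denotes the complex bilinear extension of $g$ to $TM\otimes\mathbb{C}$. For $\lambda,\mu\in\mathbb{C}$, a family $\mathcal F$ of smooth functions $M\to\mathbb{C}$ is a $(\lambda,\mu)$-eigenfamily on $M$ if for all $\varphi,\psi\in\mathcal F$: $\Delta\varphi=\lambda\varphi$ and $g_{\mathbb{C}}(\nabla\varphi,\nabla\psi)=\mu\,\varphi\psi$. Polynomials $\mathbb{R}^{m+1}\to\mathbb{C}$ are polynomials in the real coordinates with complex coefficients; the degree $d$ is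 an integer $\geq 0$, and the zero polynomial counts as homogeneous of every degree.
   Formalization: If the family is empty or contains only the zero function, (i) holds for all λ, μ while (ii) does not; for such families it is additionally assumed that λ = -d(d+m-1) and μ = -d² for some integer d ≥ 0. Nothing is added for families containing a nonzero function. *)

theory Defs
  imports "HOL-Analysis.Analysis"
begin

text \<open>
  A submanifold \<open>M\<close> of a Euclidean space is represented by its set of points and carries the
  Riemannian metric induced by the ambient inner product; for \<open>M = UNIV\<close> this is flat space and for
  \<open>M = sphere 0 1\<close> it is the round unit sphere. The notions below are the usual ones when \<open>M\<close> is an
  embedded submanifold without boundary and of positive dimension; they only depend on the values on
  \<open>M\<close> of the functions and vector fields involved.
\<close>

definition tangent_space :: "'a::euclidean_space set \<Rightarrow> 'a \<Rightarrow> 'a set" where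
  "tangent_space M p =
     {v. \<exists>\<gamma> \<epsilon>. \<epsilon> > 0 \<and> (\<forall>t::real. \<bar>t\<bar> < \<epsilon> \<longrightarrow> \<gamma> t \<in> M) \<and> \<gamma> 0 = p \<and>
            (\<gamma> has_vector_derivative v) (at 0)}"

primrec Ck_on :: "nat \<Rightarrow> 'a::euclidean_space set \<Rightarrow> ('a \<Rightarrow> 'b::real_normed_vector) \<Rightarrow> bool" where
  "Ck_on 0 U f \<longleftrightarrow> continuous_on U f"
| "Ck_on (Suc k) U f \<longleftrightarrow>
     (\<forall>x\<in>U. f differentiable (at x)) \<and> (\<forall>v. Ck_on k U (\<lambda>x. frechet_derivative f (at x) v))"

definition smooth_map_on :: "'a::euclidean_space set \<Rightarrow> ('a \<Rightarrow> 'b::real_normed_vector) \<Rightarrow> bool" where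
  "smooth_map_on M f \<longleftrightarrow>
     (\<forall>p\<in>M. \<exists>U g. open U \<and> p \<in> U \<and> (\<forall>k. Ck_on k U g) \<and> (\<forall>x\<in>U \<inter> M. g x = f x))"

text \<open>
  The derivative \<open>frechet_derivative f (at p within M)\<close> is a choice among the linear maps that
  approximate \<open>f\<close> to first order along \<open>M\<close>; all of them agree on the tangent space at \<open>p\<close>, where
  they are the differential of \<open>f\<close>. They are only evaluated there.
\<close>

definition gradient :: "'a::euclidean_space set \<Rightarrow> ('a \<Rightarrow> real) \<Rightarrow> 'a \<Rightarrow> 'a" where
  "gradient M f p =
     (THE w. w \<in> tangent_space M p \<and>
        (\<forall>v\<in>tangent_space M p. w \<bullet> v = frechet_derivative f (at p within M) v))"

definition orthogonal_projection :: "'a::euclidean_space set \<Rightarrow> 'a \<Rightarrow> 'a" where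
  "orthogonal_projection T x = (THE w. w \<in> T \<and> (\<forall>u\<in>T. (x - w) \<bullet> u = 0))"

text \<open>
  The Levi-Civita connection of the induced metric is the tangential part of the ambient
  directional derivative.
\<close>

definition covariant_derivative ::
  "'a::euclidean_space set \<Rightarrow> ('a \<Rightarrow> 'a) \<Rightarrow> 'a \<Rightarrow> 'a \<Rightarrow> 'a" where
  "covariant_derivative M X p v =
     orthogonal_projection (tangent_space M p) (frechet_derivative X (at p within M) v)"

definition orthonormal_basis_of :: "'a::euclidean_space set \<Rightarrow> 'a set \<Rightarrow> bool" where
  "orthonormal_basis_of T B \<longleftrightarrow> pairwise orthogonal B \<and> (\<forall>b\<in>B. norm b = 1) \<and> span B = T"

text \<open>The trace of an endomorphism of a subspace does not depend on the chosen basis.\<close>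

definition trace_on :: "'a::euclidean_space set \<Rightarrow> ('a \<Rightarrow> 'a) \<Rightarrow> real" where
  "trace_on T L = (\<Sum>b\<in>(SOME B. orthonormal_basis_of T B). L b \<bullet> b)"

definition divergence :: "'a::euclidean_space set \<Rightarrow> ('a \<Rightarrow> 'a) \<Rightarrow> 'a \<Rightarrow> real" where
  "divergence M X p = trace_on (tangent_space M p) (covariant_derivative M X p)"

definition laplace_beltrami :: "'a::euclidean_space set \<Rightarrow> ('a \<Rightarrow> real) \<Rightarrow> 'a \<Rightarrow> real" where
  "laplace_beltrami M f = divergence M (gradient M f)"

definition claplace_beltrami :: "'a::euclidean_space set \<Rightarrow> ('a \<Rightarrow> complex) \<Rightarrow> 'a \<Rightarrow> complex" where
  "claplace_beltrami M \<phi> p =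
     Complex (laplace_beltrami M (\<lambda>x. Re (\<phi> x)) p) (laplace_beltrami M (\<lambda>x. Im (\<phi> x)) p)"

text \<open>A complexified tangent vector \<open>u + \<i> v\<close> is represented by the pair \<open>(u, v)\<close>.\<close>

definition cgradient :: "'a::euclidean_space set \<Rightarrow> ('a \<Rightarrow> complex) \<Rightarrow> 'a \<Rightarrow> 'a \<times> 'a" where
  "cgradient M \<phi> p = (gradient M (\<lambda>x. Re (\<phi> x)) p, gradient M (\<lambda>x. Im (\<phi> x)) p)"

text \<open>The complex bilinear (not sesquilinear) extension of the inner product.\<close>

definition cmetric :: "'a::euclidean_space \<times> 'a \<Rightarrow> 'a \<times> 'a \<Rightarrow> complex" where
  "cmetric z w = Complex (fst z \<bullet> fst w - snd z \<bullet> snd w) (fst z \<bullet> snd w + snd z \<bullet> fst w)"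

definition eigenfamily ::
  "'a::euclidean_space set \<Rightarrow> complex \<Rightarrow> complex \<Rightarrow> ('a \<Rightarrow> complex) set \<Rightarrow> bool" where
  "eigenfamily M l \<mu> F \<longleftrightarrow>
     (\<forall>\<phi>\<in>F. smooth_map_on M \<phi>) \<and>
     (\<forall>\<phi>\<in>F. \<forall>p\<in>M. claplace_beltrami M \<phi> p = l * \<phi> p) \<and>
     (\<forall>\<phi>\<in>F. \<forall>\<psi>\<in>F. \<forall>p\<in>M. cmetric (cgradient M \<phi> p) (cgradient M \<psi> p) = \<mu> * \<phi> p * \<psi> p)"

text \<open>
  The sum ranges over the finitely many multi-indices of total degree \<open>d\<close>; all coefficients may be
  zero.
\<close>

definition homogeneous_polynomial :: "nat \<Rightarrow> (real^'n \<Rightarrow> complex) \<Rightarrow> bool" where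
  "homogeneous_polynomial d P \<longleftrightarrow>
     (\<exists>c :: ('n \<Rightarrow> nat) \<Rightarrow> complex.
        P = (\<lambda>x. \<Sum>\<alpha> | (\<Sum>i\<in>UNIV. \<alpha> i) = d. c \<alpha> * (\<Prod>i\<in>UNIV. complex_of_real (x $ i) ^ \<alpha> i)))"

end

(* Along the sphere, the Laplace-Beltrami operator of the restriction of f is |x|^2 (Delta f) minus
   Euler terms, and equals half the sum of the squared rotation fields x_i d_j - x_j d_i. Hence it is
   symmetric for integration over the sphere, and pairing an eigenfunction with homogeneous
   polynomials P of degree k gives (lambda + k(k+m-1)) <phi,P> = <phi,Delta P>. By induction on the
   degree and Stone-Weierstrass, lambda = -d(d+m-1) for some d and phi is a harmonic homogeneous
   polynomial P of degree d.

   For mu, note that P^k is again an eigenfunction, with eigenvalue k lambda + k(k-1) mu, which must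
   be -e(e+m-1) for some e <= k d. So the quadratic polynomial (2e+m-1)^2 in k takes square values at
   all k, which forces it to be the square of a linear one and mu = -d^2. Then |x|^2 <grad P, grad Q>
   = (d^2 + mu) P Q = 0. *)

theory Submission
  imports Defs "HOL-Real_Asymp.Real_Asymp"
begin

section \<open>Calculus of \<open>C\<^sup>k\<close> maps\<close>

text \<open>No charts and no surface measure occur. A function on the sphere is extended to be
  constant along rays, so that flat partial derivatives away from the origin compute everything
  intrinsic, and integration means integrating that extension against a radial weight. What drives
  the analysis is that rotation derivatives then integrate to zero. The identity for <phi,P> says
  nothing about <phi,P> in a resonant degree, where lambda is the eigenvalue of degree k. Without a
  resonance all moments of phi would vanish; with one, in degree d, phi has to be compared with its
  projection to the polynomials of degree d. A single P does not determine mu; the spectrum must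
  accommodate all powers of P at once. The bound e <= k d matters there: two slopes are possible for
  2e+m-1 as a function of k, namely 2d and 2(d+m-1), and only the bound discards the second.
  Families whose members all vanish on the sphere satisfy (i) for every lambda and mu. For them the
  theorem assumes that lambda and mu have the required form.\<close>

lemma Ck_on_frechet: "Ck_on (Suc k) U f \<Longrightarrow> Ck_on k U (\<lambda>x. frechet_derivative f (at x) v)"
  by simp

lemma Ck_on_cong:
  assumes "open U" "Ck_on k U f" "\<And>x. x \<in> U \<Longrightarrow> f x = g x"
  shows "Ck_on k U g"
  using assms(2,3)
proof (induction k arbitrary: f g)
  case 0
  then show ?case using continuous_on_cong[of U U f g] by simp
next
  case (Suc k)
  have d: "f differentiable at x" if "x \<in> U" for x
    using Suc.prems that by simp
  have g: "(g has_derivative frechet_derivative f (at x)) (at x)" if "x \<in> U" for x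
    by (rule has_derivative_transform_within_open[OF
          iffD1[OF frechet_derivative_works d[OF that]] assms(1) that Suc.prems(2)])
  have "g differentiable at x" "frechet_derivative g (at x) = frechet_derivative f (at x)"
    if "x \<in> U" for x
    using differentiableI[OF g[OF that]] frechet_derivative_at[OF g[OF that]] by simp_all
  then show ?case
    using Suc.IH[OF Ck_on_frechet[OF Suc.prems(1)]] by simp
qed

lemma Ck_on_SucD: "Ck_on (Suc k) U f \<Longrightarrow> Ck_on k U f"
proof (induction k arbitrary: f)
  case 0
  then show ?case
    by (auto intro!: differentiable_imp_continuous_on differentiable_at_imp_differentiable_on)
qed (simp add: Ball_def)

lemma Ck_on_imp_continuous_on: "Ck_on k U f \<Longrightarrow> continuous_on U f"
  by (induction k) (use Ck_on_SucD in auto)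

lemma Ck_on_subset: "Ck_on k U f \<Longrightarrow> V \<subseteq> U \<Longrightarrow> Ck_on k V f"
  by (induction k arbitrary: f) (auto intro: continuous_on_subset)

text \<open>\<open>smooth_map_on\<close> supplies a different extension near each point; this
  assembles regularity on a whole open set from such neighbourhoods.\<close>

lemma Ck_on_locally:
  assumes "\<And>x. x \<in> U \<Longrightarrow> \<exists>V. open V \<and> x \<in> V \<and> Ck_on k V f"
  shows "Ck_on k U f"
  using assms
proof (induction k arbitrary: f)
  case 0
  have "isCont f x" if x: "x \<in> U" for x
    using 0[OF x] by (auto simp: continuous_on_eq_continuous_at)
  then show ?case
    by (simp add: continuous_at_imp_continuous_on)
next
  case (Suc k)
  have "f differentiable at x" if "x \<in> U" for x
    using Suc.prems[OF that] by auto
  moreover have "Ck_on k U (\<lambda>x. frechet_derivative f (at x) v)" for v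
    by (rule Suc.IH) (use Suc.prems in fastforce)
  ultimately show ?case by simp
qed

lemma Ck_on_SucI:
  assumes "open U" "\<And>x. x \<in> U \<Longrightarrow> (f has_derivative f' x) (at x)" "\<And>v. Ck_on k U (\<lambda>x. f' x v)"
  shows "Ck_on (Suc k) U f"
proof -
  have "frechet_derivative f (at x) = f' x" if "x \<in> U" for x
    using assms(2)[OF that] frechet_derivative_at by metis
  then show ?thesis
    using assms by (auto simp: differentiable_def intro: Ck_on_cong[OF assms(1) assms(3)])
qed

lemma Ck_on_has_derivative:
  "Ck_on (Suc k) U f \<Longrightarrow> x \<in> U \<Longrightarrow> (f has_derivative frechet_derivative f (at x)) (at x)"
  using frechet_derivative_works by auto

lemma Ck_on_const [simp]: "Ck_on k U (\<lambda>x. c)"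
  by (induction k arbitrary: c) auto

lemma Ck_on_bounded_linear:
  assumes "open U" "bounded_linear L" "Ck_on k U f"
  shows "Ck_on k U (\<lambda>x. L (f x))"
  using assms(3)
proof (induction k arbitrary: f)
  case 0
  then show ?case
    using assms(2) by (simp add: bounded_linear.continuous_on)
next
  case (Suc k)
  show ?case
    by (rule Ck_on_SucI[OF assms(1)
          bounded_linear.has_derivative[OF assms(2) Ck_on_has_derivative[OF Suc.prems]]
          Suc.IH[OF Ck_on_frechet[OF Suc.prems]]])
qed

lemma Ck_on_id: "open U \<Longrightarrow> Ck_on k U (\<lambda>x. x)"
proof (cases k)
  case (Suc j)
  assume "open U"
  then show ?thesis unfolding Suc by (rule Ck_on_SucI[where f' = "\<lambda>x v. v"]) auto
qed (simp add: continuous_on_id)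

lemma Ck_on_linear:
  assumes "open U" "bounded_linear L"
  shows "Ck_on k U L"
  using Ck_on_bounded_linear[OF assms Ck_on_id[OF assms(1)]] .

lemma Ck_on_add:
  assumes "open U" "Ck_on k U f" "Ck_on k U g"
  shows "Ck_on k U (\<lambda>x. f x + g x)"
  using assms(2,3)
proof (induction k arbitrary: f g)
  case 0
  then show ?case by (simp add: continuous_on_add)
next
  case (Suc k)
  show ?case
    by (rule Ck_on_SucI[OF assms(1)
          has_derivative_add[OF Suc.prems[THEN Ck_on_has_derivative]]
          Suc.IH[OF Suc.prems[THEN Ck_on_frechet]]])
qed

lemma Ck_on_sum:
  assumes "open U" "\<And>i. i \<in> I \<Longrightarrow> Ck_on k U (f i)"
  shows "Ck_on k U (\<lambda>x. \<Sum>i\<in>I. f i x)"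
  using assms(2)
  by (induction I rule: infinite_finite_induct) (auto intro: Ck_on_add[OF assms(1)])

lemma Ck_on_bilinear:
  assumes "open U" "bounded_bilinear B" "Ck_on k U f" "Ck_on k U g"
  shows "Ck_on k U (\<lambda>x. B (f x) (g x))"
  using assms(3,4)
proof (induction k arbitrary: f g)
  case 0
  then show ?case
    using assms(2) by (simp add: bounded_bilinear.continuous_on)
next
  case (Suc k)
  show ?case
    by (rule Ck_on_SucI[OF assms(1)
          bounded_bilinear.FDERIV[OF assms(2) Suc.prems[THEN Ck_on_has_derivative]]
          Ck_on_add[OF assms(1)
            Suc.IH[OF Ck_on_SucD[OF Suc.prems(1)] Ck_on_frechet[OF Suc.prems(2)]]
            Suc.IH[OF Ck_on_frechet[OF Suc.prems(1)] Ck_on_SucD[OF Suc.prems(2)]]]])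
qed

lemma Ck_on_mult:
  fixes f g :: "'a::euclidean_space \<Rightarrow> 'b::real_normed_algebra"
  shows "open U \<Longrightarrow> Ck_on k U f \<Longrightarrow> Ck_on k U g \<Longrightarrow> Ck_on k U (\<lambda>x. f x * g x)"
  by (rule Ck_on_bilinear[OF _ bounded_bilinear_mult])

lemma Ck_on_compose:
  fixes N :: "'a::euclidean_space \<Rightarrow> 'c::euclidean_space"
  assumes "open U" "N ` U \<subseteq> V" "Ck_on k V f" "Ck_on k U N"
  shows "Ck_on k U (\<lambda>x. f (N x))"
  using assms(3,4)
proof (induction k arbitrary: f)
  case 0
  then show ?case
    using assms(2) continuous_on_compose2[of V f U N] by simp
next
  case (Suc k)
  let ?D = "\<lambda>x. frechet_derivative f (at (N x))"
  let ?N = "\<lambda>x. frechet_derivative N (at x)"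
  have D: "(f has_derivative ?D x) (at (N x))" "(N has_derivative ?N x) (at x)"
    if "x \<in> U" for x
    using Ck_on_has_derivative[OF Suc.prems(1), of "N x"] Ck_on_has_derivative[OF Suc.prems(2) that]
      that assms(2) by auto
  \<comment> \<open>The direction \<open>?N x v\<close> moves with \<open>x\<close>, whereas
    \<open>Ck_on\<close> controls derivatives in fixed directions only. Expanding along
    \<open>Basis\<close> turns the derivative into a sum of products to which the induction
    hypothesis applies.\<close>
  have *: "(\<Sum>b\<in>Basis. (?N x v \<bullet> b) *\<^sub>R ?D x b) = ?D x (?N x v)" if "x \<in> U" for x v
  proof -
    have l: "linear (?D x)"
      using D(1)[OF that] has_derivative_linear by blast
    have "?D x (?N x v) = ?D x (\<Sum>b\<in>Basis. (?N x v \<bullet> b) *\<^sub>R b)"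
      by (simp only: euclidean_representation)
    then show ?thesis
      by (simp only: linear_sum[OF l] linear_cmul[OF l])
  qed
  have "Ck_on k U (\<lambda>x. \<Sum>b\<in>Basis. (?N x v \<bullet> b) *\<^sub>R ?D x b)" for v
    by (intro Ck_on_sum Ck_on_bilinear[OF _ bounded_bilinear_scaleR] Suc.IH assms(1)
        Ck_on_bounded_linear[OF _ bounded_linear_inner_left]
        Ck_on_frechet[OF Suc.prems(1)] Ck_on_frechet[OF Suc.prems(2)] Ck_on_SucD[OF Suc.prems(2)])
  from Ck_on_cong[OF assms(1) this *] have "Ck_on k U (\<lambda>x. ?D x (?N x v))" for v .
  moreover have "((\<lambda>x. f (N x)) has_derivative (\<lambda>v. ?D x (?N x v))) (at x)" if "x \<in> U" for x
    using has_derivative_compose[OF D(2)[OF that] D(1)[OF that]] .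
  ultimately show ?case
    by (rule Ck_on_SucI[OF assms(1), where f' = "\<lambda>x v. ?D x (?N x v)", rotated])
qed

section \<open>Smoothness of the radial projection and the extension constant along rays\<close>

lemma open_punctured: "open (-{0::'a::euclidean_space})"
  by auto

text \<open>The derivative is a product of a linear function and powers of the same function
  \<open>inverse (norm x)\<close>, so the induction on \<open>k\<close> closes on itself.\<close>

lemma Ck_on_inverse_norm: "Ck_on k (-{0::'a::euclidean_space}) (\<lambda>x. inverse (norm x))"
proof (induction k)
  case 0
  then show ?case by (auto intro!: continuous_intros)
next
  case (Suc k)
  let ?r = "\<lambda>x::'a. inverse (norm x)"
  have "((\<lambda>x. inverse (norm x)) has_derivative (\<lambda>v. - ((x \<bullet> v) * (?r x * (?r x * ?r x))))) (at x)"
    if "x \<noteq> 0" for x :: 'a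
  proof -
    have "((\<lambda>x. inverse (norm x)) has_derivative (\<lambda>v. - (?r x * (v \<bullet> sgn x) * ?r x))) (at x)"
      using Deriv.has_derivative_inverse[OF _ has_derivative_norm[OF that]] that by simp
    then show ?thesis
      by (simp add: sgn_div_norm inner_commute field_simps)
  qed
  moreover have "Ck_on k (-{0}) (\<lambda>x::'a. - ((x \<bullet> v) * (?r x * (?r x * ?r x))))" for v
    by (intro Ck_on_bounded_linear[OF _ bounded_linear_minus[OF bounded_linear_ident]]
        Ck_on_mult Suc Ck_on_linear bounded_linear_inner_left) auto
  ultimately show ?case
    by (intro Ck_on_SucI[where f' = "\<lambda>x v. - ((x \<bullet> v) * (?r x * (?r x * ?r x)))"]) auto
qed

lemma Ck_on_sgn: "Ck_on k (-{0::'a::euclidean_space}) sgn"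
proof -
  have "sgn = (\<lambda>x::'a. inverse (norm x) *\<^sub>R x)"
    by (auto simp: sgn_div_norm)
  then show ?thesis
    by (metis Ck_on_bilinear[OF open_punctured bounded_bilinear_scaleR Ck_on_inverse_norm
          Ck_on_id[OF open_punctured]])
qed

text \<open>Trades intrinsic smoothness for ordinary differentiability of one global function on the
  punctured space; near \<open>x\<close> it is a local extension composed with
  \<open>sgn\<close>.\<close>

lemma smooth_map_on_sphere_extension:
  fixes f :: "'a::euclidean_space \<Rightarrow> 'b::real_normed_vector"
  assumes "smooth_map_on (sphere 0 1) f"
  shows "Ck_on k (-{0}) (\<lambda>x. f (sgn x))"
proof (rule Ck_on_locally)
  fix x :: 'a assume "x \<in> -{0}"
  then have "sgn x \<in> sphere 0 1" by (simp add: norm_sgn)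
  then obtain U g where "open U \<and> sgn x \<in> U \<and> (\<forall>k. Ck_on k U g) \<and> (\<forall>y\<in>U \<inter> sphere 0 1. g y = f y)"
    using assms unfolding smooth_map_on_def by metis
  then have U: "open U" "sgn x \<in> U" "Ck_on k U g" "\<And>y. y \<in> U \<Longrightarrow> norm y = 1 \<Longrightarrow> g y = f y"
    by auto
  let ?V = "-{0} \<inter> sgn -` U"
  have c: "continuous_on (-{0}) (sgn :: 'a \<Rightarrow> 'a)"
    using Ck_on_sgn Ck_on_imp_continuous_on by blast
  have V: "open ?V"
    by (rule continuous_open_preimage[OF c _ U(1)]) auto
  have "Ck_on k ?V (\<lambda>x. g (sgn x))"
    by (rule Ck_on_compose[OF V _ U(3) Ck_on_subset[OF Ck_on_sgn]]) auto
  then have "Ck_on k ?V (\<lambda>x. f (sgn x))"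
    by (rule Ck_on_cong[OF V]) (use U(4) in \<open>auto simp: norm_sgn\<close>)
  then show "\<exists>V. open V \<and> x \<in> V \<and> Ck_on k V (\<lambda>x. f (sgn x))"
    using V U(2) \<open>x \<in> -{0}\<close> by blast
qed

section \<open>Partial derivatives\<close>

definition pd :: "'n::finite \<Rightarrow> (real^'n \<Rightarrow> complex) \<Rightarrow> real^'n \<Rightarrow> complex" where
  "pd i f x = frechet_derivative f (at x) (axis i 1)"

abbreviation coord :: "'n::finite \<Rightarrow> real^'n \<Rightarrow> complex" where
  "coord i \<equiv> \<lambda>x. complex_of_real (x $ i)"

lemma pd_eqI: "(f has_derivative D) (at x) \<Longrightarrow> pd i f x = D (axis i 1)"
  by (metis frechet_derivative_at pd_def)

lemma frechet_derivative_eq_pd: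
  assumes "f differentiable at x"
  shows "frechet_derivative f (at x) v = (\<Sum>i\<in>UNIV. of_real (v $ i) * pd i f x)"
proof -
  have l: "linear (frechet_derivative f (at x))"
    using assms linear_frechet_derivative by blast
  have "v = (\<Sum>i\<in>UNIV. (v $ i) *\<^sub>R axis i 1)"
    using basis_expansion[of v] unfolding scalar_mult_eq_scaleR by simp
  then have "frechet_derivative f (at x) v = (\<Sum>i\<in>UNIV. (v $ i) *\<^sub>R pd i f x)"
    unfolding pd_def by (metis (no_types, lifting) linear_sum[OF l] linear_cmul[OF l] sum.cong)
  then show ?thesis
    unfolding scaleR_conv_of_real .
qed

lemma pd_cong:
  assumes "f differentiable at x" "open U" "x \<in> U" "\<And>y. y \<in> U \<Longrightarrow> f y = g y"
  shows "pd i f x = pd i g x"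
  unfolding pd_def using frechet_derivative_transform_within_open[OF assms] by simp

lemma pd_const [simp]: "pd i (\<lambda>x. c) x = 0"
  by (simp add: pd_def)

lemma pd_add:
  assumes "f differentiable at x" "g differentiable at x"
  shows "pd i (\<lambda>x. f x + g x) x = pd i f x + pd i g x"
  using pd_eqI[OF has_derivative_add[OF assms[unfolded frechet_derivative_works]]]
  by (simp add: pd_def)

lemma pd_diff:
  assumes "f differentiable at x" "g differentiable at x"
  shows "pd i (\<lambda>x. f x - g x) x = pd i f x - pd i g x"
  using pd_eqI[OF has_derivative_diff[OF assms[unfolded frechet_derivative_works]]]
  by (simp add: pd_def)

lemma pd_mult:
  assumes "f differentiable at x" "g differentiable at x"
  shows "pd i (\<lambda>x. f x * g x) x = f x * pd i g x + pd i f x * g x"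
  using pd_eqI[OF has_derivative_mult[OF assms[unfolded frechet_derivative_works]]]
  by (simp add: pd_def)

lemma bounded_linear_coord: "bounded_linear (coord i)"
  using bounded_linear_compose[OF bounded_linear_of_real bounded_linear_vec_nth] .

lemma coord_differentiable [simp]: "coord i differentiable at x"
  using bounded_linear_coord bounded_linear_imp_differentiable by blast

lemma pd_coord: "pd j (coord i) x = (if i = j then 1 else 0)"
proof -
  have "pd j (coord i) x = of_real (axis j 1 $ i)"
    by (rule pd_eqI[OF bounded_linear_imp_has_derivative[OF bounded_linear_coord]])
  then show ?thesis
    by (auto simp: axis_def)
qed

lemma pd_coord_mult:
  assumes "f differentiable at x"
  shows "pd j (\<lambda>x. of_real (x $ i) * f x) x = of_real (x $ i) * pd j f x + (if i = j then f x else 0)"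
  by (simp add: pd_mult[OF coord_differentiable assms] pd_coord)

lemma Ck_on_pd: "Ck_on (Suc k) U f \<Longrightarrow> Ck_on k U (pd i f)"
  unfolding pd_def by (rule Ck_on_frechet)

lemma Ck_on_differentiable: "Ck_on (Suc k) U f \<Longrightarrow> x \<in> U \<Longrightarrow> f differentiable at x"
  by simp

section \<open>Rotation fields and the Laplacian of the sphere in ambient coordinates\<close>

definition rot_deriv :: "'n::finite \<Rightarrow> 'n \<Rightarrow> (real^'n \<Rightarrow> complex) \<Rightarrow> real^'n \<Rightarrow> complex" where
  "rot_deriv i j f x = of_real (x $ i) * pd j f x - of_real (x $ j) * pd i f x"

definition laplacian :: "(real^'n::finite \<Rightarrow> complex) \<Rightarrow> real^'n \<Rightarrow> complex" where
  "laplacian f x = (\<Sum>i\<in>UNIV. pd i (pd i f) x)"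

definition radial_deriv :: "(real^'n::finite \<Rightarrow> complex) \<Rightarrow> real^'n \<Rightarrow> complex" where
  "radial_deriv f x = (\<Sum>i\<in>UNIV. of_real (x $ i) * pd i f x)"

text \<open>The Hessian of \<open>f\<close> at \<open>x\<close> evaluated on the pair
  \<open>(x, x)\<close>. It differs from applying \<open>radial_deriv\<close> twice by one
  \<open>radial_deriv f x\<close>.\<close>

definition radial_deriv2 :: "(real^'n::finite \<Rightarrow> complex) \<Rightarrow> real^'n \<Rightarrow> complex" where
  "radial_deriv2 f x = (\<Sum>i\<in>UNIV. \<Sum>j\<in>UNIV. of_real (x $ i) * of_real (x $ j) * pd j (pd i f) x)"

definition grad_prod :: "(real^'n::finite \<Rightarrow> complex) \<Rightarrow> (real^'n \<Rightarrow> complex) \<Rightarrow> real^'n \<Rightarrow> complex" where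
  "grad_prod f g x = (\<Sum>i\<in>UNIV. pd i f x * pd i g x)"

text \<open>Polar coordinates: \<open>radial_deriv2\<close> and \<open>radial_deriv\<close> are r^2
  and r times the second and first radial derivatives, and removing them from r^2 times the
  Laplacian leaves the directions along the sphere, whose dimension is
  \<open>CARD('n) - 1\<close>.\<close>

definition sphere_laplacian :: "(real^'n::finite \<Rightarrow> complex) \<Rightarrow> real^'n \<Rightarrow> complex" where
  "sphere_laplacian f x = of_real ((norm x)\<^sup>2) * laplacian f x - radial_deriv2 f x
     - of_real (real CARD('n) - 1) * radial_deriv f x"

lemma Ck_on_coord: "open U \<Longrightarrow> Ck_on k U (coord i)"
  using Ck_on_linear bounded_linear_coord by blast

lemma Ck_on_diff:
  assumes "open U" "Ck_on k U f" "Ck_on k U g"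
  shows "Ck_on k U (\<lambda>x. f x - g x)"
  using Ck_on_add[OF assms(1,2)
      Ck_on_bounded_linear[OF assms(1) bounded_linear_minus[OF bounded_linear_ident] assms(3)]]
  by simp

lemma Ck_on_rot_deriv:
  assumes "open U" "Ck_on (Suc k) U f"
  shows "Ck_on k U (rot_deriv i j f)"
  unfolding rot_deriv_def
  by (intro Ck_on_diff Ck_on_mult Ck_on_coord Ck_on_pd[OF assms(2)] assms(1))

lemma rot_deriv_mult:
  assumes "f differentiable at x" "g differentiable at x"
  shows "rot_deriv i j (\<lambda>x. f x * g x) x = f x * rot_deriv i j g x + rot_deriv i j f x * g x"
  by (simp add: rot_deriv_def pd_mult[OF assms] algebra_simps)

lemma sum_coord_square: "(\<Sum>i\<in>UNIV. complex_of_real (x $ i) * of_real (x $ i)) = of_real ((norm x)\<^sup>2)"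
  by (simp add: power2_norm_eq_inner inner_vec_def)

text \<open>Each coordinate plane is counted in both orders, hence the factor 2. The square splits
  into \<open>?T i j\<close> and the same expression with \<open>i\<close>, \<open>j\<close>
  exchanged, so both halves have the same double sum.\<close>

lemma sum_rot_deriv_twice:
  fixes x :: "real^'n"
  assumes "Ck_on (Suc (Suc 0)) U f" "x \<in> U"
  shows "(\<Sum>i\<in>UNIV. \<Sum>j\<in>UNIV. rot_deriv i j (rot_deriv i j f) x) = 2 * sphere_laplacian f x"
proof -
  let ?x = "\<lambda>i. complex_of_real (x $ i)" and ?f = "\<lambda>i. pd i f x" and ?ff = "\<lambda>i j. pd i (pd j f) x"
  have d: "pd i f differentiable at x" for i
    using Ck_on_differentiable[OF Ck_on_pd[OF assms(1)] assms(2)] .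
  have dm: "(\<lambda>x. of_real (x $ i) * pd j f x) differentiable at x" for i j
    using differentiable_mult[OF coord_differentiable d] .
  have rr: "rot_deriv i j (rot_deriv i j f) x =
      (?x i * ((if i = j then ?f j else 0) + ?x i * ?ff j j - ?f i - ?x j * ?ff j i))
    + (?x j * ((if j = i then ?f i else 0) + ?x j * ?ff i i - ?f j - ?x i * ?ff i j))" for i j
  proof -
    have "pd k (rot_deriv i j f) x = pd k (\<lambda>x. of_real (x $ i) * pd j f x) x
        - pd k (\<lambda>x. of_real (x $ j) * pd i f x) x" for k
      unfolding rot_deriv_def by (rule pd_diff[OF dm dm])
    then have r: "pd k (rot_deriv i j f) x = of_real (x $ i) * pd k (pd j f) x + (if i = k then pd j f x else 0)
        - (of_real (x $ j) * pd k (pd i f) x + (if j = k then pd i f x else 0))" for k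
      by (simp only: pd_coord_mult[OF d])
    show ?thesis
      unfolding rot_deriv_def[of i j "rot_deriv i j f"] r by (simp add: algebra_simps)
  qed
  let ?T = "\<lambda>i j. ?x i * ((if i = j then ?f j else 0) + ?x i * ?ff j j - ?f i - ?x j * ?ff j i)"
  have T: "(\<Sum>i\<in>UNIV. \<Sum>j\<in>UNIV. ?T i j) = sphere_laplacian f x"
  proof -
    have "?T i j = (if i = j then ?x i * ?f i else 0) + (?x i * ?x i) * ?ff j j - ?x i * ?f i
        - ?x i * ?x j * ?ff j i" for i j
      by (simp add: algebra_simps)
    then have "(\<Sum>i\<in>UNIV. \<Sum>j\<in>UNIV. ?T i j) = radial_deriv f x
        + (\<Sum>i\<in>UNIV. \<Sum>j\<in>UNIV. (?x i * ?x i) * ?ff j j) - of_nat CARD('n) * radial_deriv f x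
        - radial_deriv2 f x"
      by (simp add: sum.distrib sum_subtractf radial_deriv_def radial_deriv2_def sum_distrib_left)
    also have "(\<Sum>i\<in>UNIV. \<Sum>j\<in>UNIV. (?x i * ?x i) * ?ff j j)
        = (\<Sum>i\<in>UNIV. ?x i * ?x i) * laplacian f x"
      by (simp only: laplacian_def sum_product)
    finally have "(\<Sum>i\<in>UNIV. \<Sum>j\<in>UNIV. ?T i j) = radial_deriv f x
        + (\<Sum>i\<in>UNIV. ?x i * ?x i) * laplacian f x - of_nat CARD('n) * radial_deriv f x
        - radial_deriv2 f x" .
    then show ?thesis
      unfolding sum_coord_square by (simp add: sphere_laplacian_def algebra_simps)
  qed
  have "(\<Sum>i\<in>UNIV. \<Sum>j\<in>UNIV. rot_deriv i j (rot_deriv i j f) x)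
      = (\<Sum>i\<in>UNIV. \<Sum>j\<in>UNIV. ?T i j) + (\<Sum>i\<in>UNIV. \<Sum>j\<in>UNIV. ?T j i)"
    unfolding rr by (simp only: sum.distrib)
  also have "(\<Sum>i\<in>UNIV. \<Sum>j\<in>UNIV. ?T j i) = (\<Sum>i\<in>UNIV. \<Sum>j\<in>UNIV. ?T i j)"
    by (rule sum.swap)
  finally show ?thesis
    unfolding T by simp
qed

section \<open>Homogeneous polynomials\<close>

text \<open>Generation from constants by coordinate multiplication and addition replaces multi-index
  sums by rule induction; \<open>homogeneous_polynomial_iff_hpoly\<close> connects the two
  forms.\<close>

inductive hpoly :: "nat \<Rightarrow> (real^'n::finite \<Rightarrow> complex) \<Rightarrow> bool" where
  hpoly_const: "hpoly 0 (\<lambda>x. c)"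
| hpoly_coord_mult: "hpoly d P \<Longrightarrow> hpoly (Suc d) (\<lambda>x. of_real (x $ i) * P x)"
| hpoly_add: "hpoly d P \<Longrightarrow> hpoly d Q \<Longrightarrow> hpoly d (\<lambda>x. P x + Q x)"
| hpoly_zero: "hpoly d (\<lambda>x. 0)"

lemma hpoly_sum: "(\<And>i. i \<in> I \<Longrightarrow> hpoly d (P i)) \<Longrightarrow> hpoly d (\<lambda>x. \<Sum>i\<in>I. P i x)"
  by (induction I rule: infinite_finite_induct) (auto intro: hpoly_zero hpoly_add)

lemma hpoly_cmult: "hpoly d P \<Longrightarrow> hpoly d (\<lambda>x. c * P x)"
proof (induction rule: hpoly.induct)
  case (hpoly_coord_mult d P i)
  show ?case using hpoly.hpoly_coord_mult[OF hpoly_coord_mult.IH, of i]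
    by (simp add: mult.left_commute)
qed (auto simp: distrib_left intro: hpoly.intros)

lemma hpoly_mult: "hpoly d P \<Longrightarrow> hpoly e Q \<Longrightarrow> hpoly (d + e) (\<lambda>x. P x * Q x)"
proof (induction rule: hpoly.induct)
  case (hpoly_coord_mult d P i)
  show ?case
    using hpoly.hpoly_coord_mult[OF hpoly_coord_mult.IH[OF hpoly_coord_mult.prems], of i]
    by (simp add: mult.assoc)
qed (auto simp: distrib_right intro: hpoly.intros hpoly_cmult)

lemma hpoly_power: "hpoly d P \<Longrightarrow> hpoly (k * d) (\<lambda>x. P x ^ k)"
  by (induction k) (auto intro: hpoly_const dest: hpoly_mult)

lemma hpoly_cnj: "hpoly d P \<Longrightarrow> hpoly d (\<lambda>x. cnj (P x))"
  by (induction rule: hpoly.induct) (auto intro: hpoly.intros)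

lemma hpoly_coord: "hpoly 1 (coord i)"
  using hpoly_coord_mult[OF hpoly_const[of 1]] by simp

lemma hpoly_diff: "hpoly d P \<Longrightarrow> hpoly d Q \<Longrightarrow> hpoly d (\<lambda>x. P x - Q x)"
  using hpoly_add[of d P "\<lambda>x. (-1) * Q x"] hpoly_cmult[of d Q "-1"] by simp

lemma hpoly_Ck_on: "hpoly d P \<Longrightarrow> Ck_on k UNIV P"
proof (induction rule: hpoly.induct)
  case (hpoly_coord_mult d P i)
  show ?case by (rule Ck_on_mult[OF open_UNIV Ck_on_coord[OF open_UNIV] hpoly_coord_mult.IH])
next
  case (hpoly_add d P Q)
  show ?case by (rule Ck_on_add[OF open_UNIV hpoly_add.IH])
qed (rule Ck_on_const)+

lemma hpoly_differentiable: "hpoly d P \<Longrightarrow> P differentiable at x"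
  using Ck_on_differentiable[OF hpoly_Ck_on[of d P "Suc 0"]] by simp

lemma hpoly_scaleR: "hpoly d P \<Longrightarrow> P (t *\<^sub>R x) = of_real t ^ d * P x"
  by (induction rule: hpoly.induct) (auto simp: algebra_simps)

lemma hpoly_pd_0: "hpoly 0 P \<Longrightarrow> pd i P = (\<lambda>x. 0)"
proof -
  assume "hpoly 0 P"
  \<comment> \<open>Scaling by \<open>t = 0\<close>, with \<open>0 ^ 0 = 1\<close>.\<close>
  then have "P x = P 0" for x
    using hpoly_scaleR[of 0 P 0 x] by simp
  then have "P = (\<lambda>x. P 0)" ..
  moreover have "pd i (\<lambda>x. P 0) = (\<lambda>x. 0)"
    by (rule ext) simp
  ultimately show ?thesis
    by metis
qed

lemma hpoly_pd: "hpoly d P \<Longrightarrow> hpoly (d - 1) (pd i P)"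
proof (induction rule: hpoly.induct)
  case (hpoly_const c)
  have "pd i (\<lambda>x. c) = (\<lambda>x. 0)" by (rule ext) simp
  then show ?case by (simp add: hpoly_zero)
next
  case (hpoly_coord_mult d P j)
  have "pd i (\<lambda>x. of_real (x $ j) * P x) = (\<lambda>x. of_real (x $ j) * pd i P x + (if i = j then P x else 0))"
    by (rule ext) (simp add: pd_coord_mult[OF hpoly_differentiable[OF hpoly_coord_mult.hyps]])
  \<comment> \<open>For \<open>d = 0\<close> the truncated \<open>d - 1\<close> would give this
    product degree 1; it has degree 0 because \<open>pd i P\<close> is zero.\<close>
  moreover have "hpoly d (\<lambda>x. of_real (x $ j) * pd i P x)"
  proof (cases d)
    case 0
    then show ?thesis
      using hpoly_pd_0[of P i] hpoly_coord_mult.hyps by (simp add: hpoly_zero)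
  next
    case (Suc e)
    then show ?thesis
      using hpoly.hpoly_coord_mult[OF hpoly_coord_mult.IH] by simp
  qed
  moreover have "hpoly d (\<lambda>x. if i = j then P x else 0)"
    using hpoly_coord_mult.hyps by (cases "i = j") (auto intro: hpoly_zero)
  ultimately show ?case
    by (simp add: hpoly_add)
next
  case (hpoly_add d P Q)
  have "pd i (\<lambda>x. P x + Q x) = (\<lambda>x. pd i P x + pd i Q x)"
    by (rule ext) (simp add: pd_add hpoly_differentiable[OF hpoly_add.hyps(1)]
        hpoly_differentiable[OF hpoly_add.hyps(2)])
  then show ?case
    using hpoly.hpoly_add[OF hpoly_add.IH] by simp
next
  case (hpoly_zero d)
  have "pd i (\<lambda>x. 0) = (\<lambda>x. 0)" by (rule ext) simp
  then show ?case by (simp add: hpoly.hpoly_zero)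
qed

text \<open>Euler's identity: by the product rule every coordinate factor contributes one copy of
  the polynomial.\<close>

lemma hpoly_radial_deriv: "hpoly d P \<Longrightarrow> radial_deriv P x = of_nat d * P x"
proof (induction rule: hpoly.induct)
  case (hpoly_coord_mult d P i)
  have "radial_deriv (\<lambda>x. of_real (x $ i) * P x) x
      = of_real (x $ i) * radial_deriv P x + of_real (x $ i) * P x"
    by (simp add: radial_deriv_def pd_coord_mult[OF hpoly_differentiable[OF hpoly_coord_mult.hyps]]
        distrib_left sum.distrib sum_distrib_left mult.left_commute
        if_distrib[where f = "(*) c" for c] cong: if_cong)
  then show ?case
    unfolding hpoly_coord_mult.IH by (simp add: algebra_simps)
next
  case (hpoly_add d P Q)
  have "radial_deriv (\<lambda>x. P x + Q x) x = radial_deriv P x + radial_deriv Q x"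
    by (simp add: radial_deriv_def pd_add hpoly_differentiable[OF hpoly_add.hyps(1)]
        hpoly_differentiable[OF hpoly_add.hyps(2)] sum.distrib distrib_left)
  then show ?case
    using hpoly_add.IH by (simp add: distrib_left)
qed (simp_all add: radial_deriv_def)

lemma hpoly_radial_deriv2:
  assumes "hpoly d P"
  shows "radial_deriv2 P x = of_nat (d * (d - 1)) * P x"
proof -
  have "radial_deriv2 P x = (\<Sum>i\<in>UNIV. of_real (x $ i) * radial_deriv (pd i P) x)"
    unfolding radial_deriv2_def radial_deriv_def sum_distrib_left mult.assoc ..
  also have "\<dots> = of_nat (d - 1) * radial_deriv P x"
    by (simp only: hpoly_radial_deriv[OF hpoly_pd[OF assms]] radial_deriv_def[of P]
        sum_distrib_left mult.left_commute)
  finally show ?thesis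
    by (simp add: hpoly_radial_deriv[OF assms])
qed

lemma hpoly_laplacian: "hpoly d P \<Longrightarrow> hpoly (d - 2) (laplacian P)"
  unfolding laplacian_def diff_diff_left one_add_one[symmetric]
  by (rule hpoly_sum[OF hpoly_pd[OF hpoly_pd, unfolded diff_diff_left]])

text \<open>For \<open>d < 2\<close> the truncated degree \<open>d - 2\<close> only yields a
  constant. Its vanishing is what ends a descent that lowers the degree by two.\<close>

lemma hpoly_laplacian_less_2:
  assumes "hpoly d P" "d < 2"
  shows "laplacian P x = 0"
proof -
  have "d - 1 = 0" using assms(2) by simp
  then have "hpoly 0 (pd i P)" for i
    using hpoly_pd[OF assms(1), of i] by (simp only:)
  then show ?thesis
    by (simp add: laplacian_def hpoly_pd_0)
qed

lemma hpoly_grad_prod: "hpoly d P \<Longrightarrow> hpoly e Q \<Longrightarrow> hpoly ((d - 1) + (e - 1)) (grad_prod P Q)"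
  unfolding grad_prod_def by (rule hpoly_sum[OF hpoly_mult[OF hpoly_pd hpoly_pd]])

text \<open>By Euler's identity the radial terms add up to
  \<open>d (d - 1) + (CARD('n) - 1) d\<close>. A harmonic \<open>P\<close> thus restricts to an
  eigenfunction of the sphere.\<close>

lemma hpoly_sphere_laplacian:
  fixes P :: "real^'n \<Rightarrow> complex"
  assumes "hpoly d P"
  shows "sphere_laplacian P x = of_real ((norm x)\<^sup>2) * laplacian P x
    - of_nat d * (of_nat d + of_nat CARD('n) - 2) * P x"
proof -
  have "complex_of_nat (d * (d - 1)) = of_nat d * (of_nat d - 1)"
    by (cases d) (auto simp: algebra_simps)
  then show ?thesis
    by (simp add: sphere_laplacian_def hpoly_radial_deriv[OF assms] hpoly_radial_deriv2[OF assms]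
        algebra_simps)
qed

lemma hpoly_eq_on_sphere:
  fixes P Q :: "real^'n \<Rightarrow> complex"
  assumes "hpoly d P" "hpoly d Q" "\<And>x. norm x = 1 \<Longrightarrow> P x = Q x"
  shows "P = Q"
proof
  fix x :: "real^'n"
  obtain u :: "real^'n" where "norm u = 1" "x = norm x *\<^sub>R u"
  proof (cases "x = 0")
    case True
    then show ?thesis using that[of "axis undefined 1"] by (simp add: norm_axis_1)
  next
    case False
    then show ?thesis using that[of "sgn x"] by (simp add: norm_sgn sgn_div_norm)
  qed
  then show "P x = Q x"
    using hpoly_scaleR[OF assms(1), of "norm x" u] hpoly_scaleR[OF assms(2), of "norm x" u]
      assms(3)[of u] by simp
qed

section \<open>Agreement with polynomials given by coefficients\<close>

lemma finite_multi_indices: "finite {\<alpha>::'n::finite \<Rightarrow> nat. (\<Sum>i\<in>UNIV. \<alpha> i) = d}"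
proof (rule finite_subset)
  show "{\<alpha>::'n \<Rightarrow> nat. (\<Sum>i\<in>UNIV. \<alpha> i) = d} \<subseteq> Pi\<^sub>E UNIV (\<lambda>_. {..d})"
    by (auto simp: PiE_def Pi_def member_le_sum)
qed (simp add: finite_PiE)

lemma hpoly_monomial:
  fixes \<alpha> :: "'n::finite \<Rightarrow> nat"
  shows "hpoly (\<Sum>i\<in>UNIV. \<alpha> i) (\<lambda>x. \<Prod>i\<in>UNIV. complex_of_real (x $ i) ^ \<alpha> i)"
proof -
  have "hpoly (\<Sum>i\<in>I. \<alpha> i) (\<lambda>x. \<Prod>i\<in>I. complex_of_real (x $ i) ^ \<alpha> i)" if "finite I" for I
    using that
  proof (induction I rule: finite_induct)
    case (insert i I)
    then show ?case
      using hpoly_mult[OF hpoly_power[OF hpoly_coord, of "\<alpha> i" i] insert.IH] by simp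
  qed (simp add: hpoly_const)
  then show ?thesis by simp
qed

lemma homogeneous_polynomial_iff_hpoly:
  fixes P :: "real^'n \<Rightarrow> complex"
  shows "homogeneous_polynomial d P \<longleftrightarrow> hpoly d P"
proof
  assume "homogeneous_polynomial d P"
  then obtain c where P: "P = (\<lambda>x. \<Sum>\<alpha> | (\<Sum>i\<in>UNIV. \<alpha> i) = d.
      c \<alpha> * (\<Prod>i\<in>UNIV. complex_of_real (x $ i) ^ \<alpha> i))"
    unfolding homogeneous_polynomial_def by blast
  show "hpoly d P"
    unfolding P by (intro hpoly_sum hpoly_cmult) (use hpoly_monomial in blast)
next
  assume "hpoly d P"
  then show "homogeneous_polynomial d P"
  proof (induction rule: hpoly.induct)
    case (hpoly_const c)
    have "{\<alpha>. (\<Sum>i\<in>UNIV. \<alpha> (i::'n)) = (0::nat)} = {\<lambda>_. 0}"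
      by (auto simp: fun_eq_iff)
    then show ?case
      unfolding homogeneous_polynomial_def by (intro exI[of _ "\<lambda>_. c"]) simp
  next
    case (hpoly_coord_mult d P k)
    let ?m = "\<lambda>\<alpha> x. \<Prod>i\<in>UNIV. complex_of_real (x $ (i::'n)) ^ \<alpha> i"
    let ?up = "\<lambda>\<alpha>::'n \<Rightarrow> nat. \<alpha>(k := Suc (\<alpha> k))"
    let ?A = "\<lambda>d. {\<alpha>::'n \<Rightarrow> nat. (\<Sum>i\<in>UNIV. \<alpha> i) = d}"
    obtain c where P: "P = (\<lambda>x. \<Sum>\<alpha>\<in>?A d. c \<alpha> * ?m \<alpha> x)"
      using hpoly_coord_mult.IH unfolding homogeneous_polynomial_def by blast
    \<comment> \<open>Multiplication by the \<open>k\<close>-th coordinate shifts multi-indices by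
      \<open>?up\<close>. Indices with \<open>\<beta> k = 0\<close> are not reached and receive
      coefficient 0.\<close>
    define c' where "c' \<beta> = (if \<beta> k = 0 then 0 else c (\<beta>(k := \<beta> k - 1)))" for \<beta>
    have s: "(\<Sum>i\<in>UNIV. \<alpha> i) = \<alpha> k + (\<Sum>i\<in>UNIV - {k}. \<alpha> i)" for \<alpha> :: "'n \<Rightarrow> nat"
      by (rule sum.remove) auto
    have img: "?up ` ?A d = ?A (Suc d) \<inter> {\<beta>. \<beta> k \<noteq> 0}"
    proof (intro equalityI subsetI)
      fix \<beta> assume \<beta>: "\<beta> \<in> ?A (Suc d) \<inter> {\<beta>. \<beta> k \<noteq> 0}"
      then have "\<beta> = ?up (\<beta>(k := \<beta> k - 1))"
        by auto
      moreover have "\<beta>(k := \<beta> k - 1) \<in> ?A d"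
        using \<beta> s[of \<beta>] s[of "\<beta>(k := \<beta> k - 1)"] by auto
      ultimately show "\<beta> \<in> ?up ` ?A d" by (rule image_eqI)
    next
      fix \<beta> assume "\<beta> \<in> ?up ` ?A d"
      then obtain \<alpha> where "\<alpha> \<in> ?A d" "\<beta> = ?up \<alpha>" by auto
      then show "\<beta> \<in> ?A (Suc d) \<inter> {\<beta>. \<beta> k \<noteq> 0}"
        using s[of \<alpha>] s[of \<beta>] by simp
    qed
    have inj: "inj_on ?up (?A d)"
      by (rule inj_onI) (metis fun_upd_idem_iff fun_upd_same fun_upd_upd nat.inject)
    have m: "?m (?up \<alpha>) x = of_real (x $ k) * ?m \<alpha> x" for \<alpha> x
      by (simp add: prod.remove[of UNIV k])
    have c': "c' (?up \<alpha>) = c \<alpha>" for \<alpha>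
      by (simp add: c'_def)
    have "of_real (x $ k) * P x = (\<Sum>\<beta>\<in>?A (Suc d). c' \<beta> * ?m \<beta> x)" for x
    proof -
      have "(\<Sum>\<beta>\<in>?A (Suc d). c' \<beta> * ?m \<beta> x) = (\<Sum>\<beta>\<in>?up ` ?A d. c' \<beta> * ?m \<beta> x)"
        unfolding img
        by (rule sum.mono_neutral_right[OF finite_multi_indices]) (auto simp: c'_def)
      also have "\<dots> = (\<Sum>\<alpha>\<in>?A d. c' (?up \<alpha>) * ?m (?up \<alpha>) x)"
        by (rule sum.reindex_cong[OF inj refl refl])
      also have "\<dots> = (\<Sum>\<alpha>\<in>?A d. of_real (x $ k) * (c \<alpha> * ?m \<alpha> x))"
        by (rule sum.cong) (simp_all only: m c' mult.left_commute)
      finally show ?thesis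
        by (simp add: P sum_distrib_left)
    qed
    then show ?case
      unfolding homogeneous_polynomial_def by (intro exI[of _ c'] ext)
  next
    case (hpoly_add d P Q)
    obtain a where a: "P = (\<lambda>x. \<Sum>\<alpha> | (\<Sum>i\<in>UNIV. \<alpha> i) = d.
        a \<alpha> * (\<Prod>i\<in>UNIV. complex_of_real (x $ i) ^ \<alpha> i))"
      using hpoly_add.IH(1) unfolding homogeneous_polynomial_def ..
    obtain b where b: "Q = (\<lambda>x. \<Sum>\<alpha> | (\<Sum>i\<in>UNIV. \<alpha> i) = d.
        b \<alpha> * (\<Prod>i\<in>UNIV. complex_of_real (x $ i) ^ \<alpha> i))"
      using hpoly_add.IH(2) unfolding homogeneous_polynomial_def ..
    show ?case
      unfolding homogeneous_polynomial_def a b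
      by (intro exI[of _ "\<lambda>\<alpha>. a \<alpha> + b \<alpha>"]) (simp add: sum.distrib distrib_right)
  next
    case (hpoly_zero d)
    show ?case
      unfolding homogeneous_polynomial_def by (intro exI[of _ "\<lambda>_. 0"]) simp
  qed
qed

section \<open>Products and powers of harmonic polynomials\<close>

lemma laplacian_mult:
  assumes "hpoly d P" "hpoly e Q"
  shows "laplacian (\<lambda>x. P x * Q x) x = P x * laplacian Q x + laplacian P x * Q x + 2 * grad_prod P Q x"
proof -
  note D = hpoly_differentiable[OF assms(1)] hpoly_differentiable[OF assms(2)]
    hpoly_differentiable[OF hpoly_pd[OF assms(1)]] hpoly_differentiable[OF hpoly_pd[OF assms(2)]]
  have "pd i (\<lambda>x. P x * Q x) = (\<lambda>x. P x * pd i Q x + pd i P x * Q x)" for i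
    by (rule ext) (simp add: pd_mult D)
  then have "pd i (pd i (\<lambda>x. P x * Q x)) x
      = P x * pd i (pd i Q) x + pd i (pd i P) x * Q x + 2 * (pd i P x * pd i Q x)" for i
    by (simp add: pd_add pd_mult D algebra_simps)
  then show ?thesis
    by (simp add: laplacian_def grad_prod_def sum.distrib sum_distrib_left sum_distrib_right)
qed

lemma grad_prod_power:
  assumes "hpoly d P"
  shows "grad_prod P (\<lambda>x. P x ^ Suc k) x = of_nat (Suc k) * P x ^ k * grad_prod P P x"
proof -
  have "pd i (\<lambda>x. P x ^ Suc k) x = of_nat (Suc k) * P x ^ k * pd i P x" for i
  proof (induction k)
    case (Suc k)
    have "pd i (\<lambda>x. P x ^ Suc (Suc k)) x = P x * pd i (\<lambda>x. P x ^ Suc k) x + pd i P x * P x ^ Suc k"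
      using pd_mult[OF hpoly_differentiable[OF assms]
          hpoly_differentiable[OF hpoly_power[OF assms, of "Suc k"]]] by simp
    then show ?case
      unfolding Suc by (simp add: algebra_simps)
  qed simp
  then show ?thesis
    by (simp add: grad_prod_def sum_distrib_left algebra_simps)
qed

text \<open>Each further factor \<open>P\<close> contributes a cross term
  \<open>2 * grad_prod\<close>, and these add up to \<open>Suc k * k\<close>. At
  \<open>k = 0\<close> this coefficient vanishes, which absorbs the truncated exponent
  \<open>k - 1\<close>.\<close>

lemma laplacian_power:
  assumes "hpoly d P" "\<And>x. laplacian P x = 0"
  shows "laplacian (\<lambda>x. P x ^ Suc k) x = of_nat (Suc k * k) * P x ^ (k - 1) * grad_prod P P x"
proof (induction k)
  case 0
  then show ?case using assms(2) by simp
next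
  case (Suc k)
  have "laplacian (\<lambda>x. P x ^ Suc (Suc k)) x
      = P x * laplacian (\<lambda>x. P x ^ Suc k) x + 2 * grad_prod P (\<lambda>x. P x ^ Suc k) x"
    using laplacian_mult[OF assms(1) hpoly_power[OF assms(1), of "Suc k"]] assms(2) by simp
  then show ?case
    unfolding Suc grad_prod_power[OF assms(1)] by (cases k) (simp_all add: algebra_simps)
qed

section \<open>Integration over the sphere\<close>

lemma integrable_compact_support:
  fixes F :: "'a::euclidean_space \<Rightarrow> 'b::{banach,second_countable_topology}"
  assumes "continuous_on UNIV F" "\<And>x. r \<le> norm x \<Longrightarrow> F x = 0"
  shows "integrable lborel F"
proof -
  have "integrable lborel (\<lambda>x. indicator (cball 0 r) x *\<^sub>R F x)"
    by (rule borel_integrable_compact[OF compact_cball continuous_on_subset[OF assms(1)]]) simp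
  moreover have "(\<lambda>x. indicator (cball 0 r) x *\<^sub>R F x) = F"
    using assms(2) by (auto simp: fun_eq_iff indicator_def)
  ultimately show ?thesis by simp
qed

text \<open>The mean value inequality along one line. It bounds the difference quotients in
  direction \<open>v\<close> uniformly, as dominated convergence requires.\<close>

lemma norm_diff_le_directional_derivative:
  fixes F :: "'a::real_normed_vector \<Rightarrow> 'b::real_normed_vector"
  assumes D: "\<And>x. (F has_derivative F' x) (at x)" and B: "\<And>x. norm (F' x v) \<le> B"
    and "0 \<le> t"
  shows "norm (F (x + t *\<^sub>R v) - F x) \<le> B * t"
proof -
  have "((\<lambda>s. F (x + s *\<^sub>R v)) has_derivative (\<lambda>h. h *\<^sub>R F' (x + s *\<^sub>R v) v)) (at s within UNIV)" for s
  proof -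
    have "((\<lambda>s. x + s *\<^sub>R v) has_derivative (\<lambda>h. h *\<^sub>R v)) (at s)"
      by (auto intro!: derivative_eq_intros)
    from has_derivative_compose[OF this D[of "x + s *\<^sub>R v"]] show ?thesis
      using linear_cmul[OF has_derivative_linear[OF D[of "x + s *\<^sub>R v"]], of _ v] by simp
  qed
  moreover have "onorm (\<lambda>h. h *\<^sub>R F' (x + s *\<^sub>R v) v) \<le> B" for s
    by (rule onorm_le) (use B[of "x + s *\<^sub>R v"] in \<open>simp add: mult.commute[of B] mult_left_mono\<close>)
  ultimately have "norm (F (x + t *\<^sub>R v) - F (x + 0 *\<^sub>R v)) \<le> B * norm (t - 0)"
    by (rule differentiable_bound[OF convex_UNIV]) auto
  then show ?thesis
    using assms(3) by simp
qed

text \<open>The difference quotients of \<open>F\<close> integrate to zero by translation invariance.\<close>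

lemma integral_directional_derivative_eq_0:
  fixes F :: "'a::euclidean_space \<Rightarrow> 'b::{banach,second_countable_topology}"
  assumes D: "\<And>x. (F has_derivative F' x) (at x)"
    and cont: "continuous_on UNIV (\<lambda>x. F' x v)"
    and zero: "\<And>x. r \<le> norm x \<Longrightarrow> F x = 0" "\<And>x. r \<le> norm x \<Longrightarrow> F' x v = 0"
  shows "integrable lborel (\<lambda>x. F' x v)" "(\<integral>x. F' x v \<partial>lborel) = 0"
proof -
  show "integrable lborel (\<lambda>x. F' x v)"
    by (rule integrable_compact_support[OF cont zero(2)])
  have contF: "continuous_on UNIV F"
    by (rule continuous_at_imp_continuous_on) (simp add: has_derivative_continuous[OF D])
  have intF: "integrable lborel F"
    by (rule integrable_compact_support[OF contF zero(1)])
  obtain B where B: "\<And>x. norm (F' x v) \<le> B"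
  proof -
    have "bounded ((\<lambda>x. F' x v) ` cball 0 r)"
      by (intro compact_imp_bounded compact_continuous_image continuous_on_subset[OF cont]) auto
    then obtain B where B: "\<And>x. x \<in> cball 0 r \<Longrightarrow> norm (F' x v) \<le> B"
      unfolding bounded_iff by blast
    have "norm (F' x v) \<le> max B 0" for x
      using B[of x] zero(2)[of x] by (cases "norm x \<le> r") (auto simp: le_max_iff_disj)
    then show ?thesis by (rule that)
  qed
  define s where "s n x = real (Suc n) *\<^sub>R (F (x + (1 / real (Suc n)) *\<^sub>R v) - F x)" for n x
  have sint: "(\<integral>x. s n x \<partial>lborel) = 0" for n
  proof -
    let ?w = "(1 / real (Suc n)) *\<^sub>R v"
    have Fb: "F \<in> borel_measurable borel"
      using contF by (rule borel_measurable_continuous_onI)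
    have "(\<integral>x. F x \<partial>lborel) = (\<integral>x. F x \<partial>distr lborel borel ((+) ?w))"
      by (simp add: lborel_distr_plus)
    also have "\<dots> = (\<integral>x. F (x + ?w) \<partial>lborel)"
      by (subst integral_distr) (auto simp: Fb add.commute)
    finally have e: "(\<integral>x. F (x + ?w) \<partial>lborel) = (\<integral>x. F x \<partial>lborel)" ..
    have "continuous_on UNIV (\<lambda>x. F (x + ?w))"
      by (rule continuous_on_compose2[OF contF]) (auto intro!: continuous_intros)
    then have "integrable lborel (\<lambda>x. F (x + ?w))"
    proof (rule integrable_compact_support[where r = "r + norm ?w"])
      show "F (x + ?w) = 0" if "r + norm ?w \<le> norm x" for x
        using norm_diff_ineq[of x ?w] that by (intro zero(1)) linarith
    qed
    then show ?thesis
      unfolding s_def using intF e by simp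
  qed
  have "(\<lambda>n. \<integral>x. s n x \<partial>lborel) \<longlonglongrightarrow> (\<integral>x. F' x v \<partial>lborel)"
  \<comment> \<open>Steps of length at most \<open>norm v\<close> keep the quotients supported in
    the ball of radius \<open>r + norm v\<close>, and there the mean value bound \<open>B\<close>
    holds for all \<open>n\<close>.\<close>
  proof (rule integral_dominated_convergence[where w = "\<lambda>x. B * indicator (cball 0 (r + norm v)) x"])
    show "(\<lambda>x. F' x v) \<in> borel_measurable lborel"
      using borel_measurable_continuous_onI[OF cont] by simp
    show "s n \<in> borel_measurable lborel" for n
    proof -
      have "continuous_on UNIV (s n)"
        unfolding s_def by (intro continuous_intros continuous_on_compose2[OF contF]) auto
      from borel_measurable_continuous_onI[OF this] show ?thesis by simp
    qed
    show "integrable lborel (\<lambda>x. B * indicator (cball 0 (r + norm v)) x)"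
      using borel_integrable_compact[OF compact_cball continuous_on_const, of 0 "r + norm v" B]
      by (simp add: mult.commute)
    show "AE x in lborel. norm (s n x) \<le> B * indicator (cball 0 (r + norm v)) x" for n
    proof (rule AE_I2)
      fix x
      let ?t = "1 / real (Suc n)"
      have t: "0 \<le> ?t" "?t \<le> 1" by simp_all
      show "norm (s n x) \<le> B * indicator (cball 0 (r + norm v)) x"
      proof (cases "norm x \<le> r + norm v")
        case True
        have "norm (F (x + ?t *\<^sub>R v) - F x) \<le> B * ?t"
          by (rule norm_diff_le_directional_derivative[OF D B t(1)])
        then have "real (Suc n) * norm (F (x + ?t *\<^sub>R v) - F x) \<le> B"
          by (simp add: pos_le_divide_eq mult.commute del: of_nat_Suc)
        then show ?thesis
          using True by (simp add: s_def del: of_nat_Suc)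
      next
        case False
        have "norm (?t *\<^sub>R v) \<le> norm v"
          using mult_right_mono[OF t(2), of "norm v"] by simp
        then have "r \<le> norm (x + ?t *\<^sub>R v)" "r \<le> norm x"
          using False norm_diff_ineq[of x "?t *\<^sub>R v"] by (linarith, use False norm_ge_zero[of v] in linarith)
        then show ?thesis
          by (simp add: s_def zero(1) False)
      qed
    qed
    show "AE x in lborel. (\<lambda>n. s n x) \<longlonglongrightarrow> F' x v"
    proof (rule AE_I2, rule LIMSEQ_I)
      fix x and e :: real assume "0 < e"
      \<comment> \<open>\<open>e' * norm v\<close> has to be below \<open>e\<close>; the added 1
        covers \<open>v = 0\<close>.\<close>
      define e' where "e' = e / (norm v + 1)"
      have e': "0 < e'" "e' * norm v < e"
      proof -
        have "0 < norm v + 1" using norm_ge_zero[of v] by linarith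
        then show "0 < e'" "e' * norm v < e"
          using \<open>0 < e\<close> by (simp_all add: e'_def pos_divide_less_eq distrib_left)
      qed
      obtain d where d: "d > 0"
        "\<And>y. norm (y - x) < d \<Longrightarrow> norm (F y - F x - F' x (y - x)) \<le> e' * norm (y - x)"
        using D[of x] e'(1) unfolding has_derivative_at_alt by blast
      obtain N where N: "norm v / d < real N" using reals_Archimedean2 by blast
      show "\<exists>no. \<forall>n\<ge>no. norm (s n x - F' x v) < e"
      proof (intro exI[of _ N] allI impI)
        fix n assume "n \<ge> N"
        let ?k = "real (Suc n)"
        have "norm v / d < ?k" using N \<open>n \<ge> N\<close> by simp
        then have "norm ((1 / ?k) *\<^sub>R v) < d"
          using d(1) by (simp add: field_simps)
        then have "norm (F (x + (1 / ?k) *\<^sub>R v) - F x - F' x ((1 / ?k) *\<^sub>R v)) \<le> e' * (norm v / ?k)"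
          using d(2)[of "x + (1 / ?k) *\<^sub>R v"] by simp
        moreover have "s n x - F' x v = ?k *\<^sub>R (F (x + (1 / ?k) *\<^sub>R v) - F x - F' x ((1 / ?k) *\<^sub>R v))"
          unfolding s_def linear_cmul[OF has_derivative_linear[OF D]]
          by (simp add: scaleR_diff_right)
        ultimately have "norm (s n x - F' x v) \<le> ?k * (e' * (norm v / ?k))"
          by (simp only: norm_scaleR abs_of_nat mult_left_mono of_nat_0_le_iff)
        then show "norm (s n x - F' x v) < e"
          using e'(2) by simp
      qed
    qed
  qed
  then have "(\<lambda>n. 0) \<longlonglongrightarrow> (\<integral>x. F' x v \<partial>lborel)"
    by (simp only: sint)
  then show "(\<integral>x. F' x v \<partial>lborel) = 0"
    using LIMSEQ_unique[OF _ tendsto_const] by metis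
qed

text \<open>A \<open>C\<^sup>1\<close> weight that keeps the singularity of \<open>sgn x = x / |x|\<close> at the origin out of the integrals.\<close>

definition shell_cutoff :: "'a::euclidean_space \<Rightarrow> real" where
  "shell_cutoff x = (max 0 (((norm x)\<^sup>2 - 1) * (4 - (norm x)\<^sup>2)))\<^sup>2"

text \<open>The gradient of the radial weight \<open>shell_cutoff\<close> at \<open>x\<close> is
  \<open>shell_slope x\<close> times \<open>x\<close>; only the scalar factor is named.\<close>

definition shell_slope :: "'a::euclidean_space \<Rightarrow> real" where
  "shell_slope x = 2 * max 0 (((norm x)\<^sup>2 - 1) * (4 - (norm x)\<^sup>2)) * (2 * (5 - 2 * (norm x)\<^sup>2))"

lemma shell_outside:
  fixes x :: "'a::euclidean_space"
  assumes "norm x \<le> 1 \<or> 2 \<le> norm x"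
  shows "shell_cutoff x = 0" "shell_slope x = 0"
proof -
  have "(norm x)\<^sup>2 \<le> 1 \<or> 4 \<le> (norm x)\<^sup>2"
    using assms abs_le_square_iff[of "norm x" 1] abs_le_square_iff[of 2 "norm x"] by auto
  then have "((norm x)\<^sup>2 - 1) * (4 - (norm x)\<^sup>2) \<le> 0"
    by (smt (verit, best) mult_nonneg_nonpos mult_nonpos_nonneg zero_le_power2)
  then show "shell_cutoff x = 0" "shell_slope x = 0"
    by (simp_all add: shell_cutoff_def shell_slope_def max_def)
qed

lemma shell_cutoff_nonneg: "0 \<le> shell_cutoff x"
  by (simp add: shell_cutoff_def)

lemma shell_cutoff_pos:
  fixes x :: "'a::euclidean_space"
  assumes "1 < norm x" "norm x < 2"
  shows "0 < shell_cutoff x"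
proof -
  have "1 < (norm x)\<^sup>2" "(norm x)\<^sup>2 < 2\<^sup>2"
    using assms power_strict_mono[of "norm x" 2 2] by (simp_all add: one_less_power)
  then have "0 < ((norm x)\<^sup>2 - 1) * (4 - (norm x)\<^sup>2)"
    by (intro mult_pos_pos) auto
  then show ?thesis
    unfolding shell_cutoff_def by (intro zero_less_power) (auto simp only: less_max_iff_disj)
qed

lemma continuous_shell: "continuous_on S shell_cutoff" "continuous_on S shell_slope"
  unfolding shell_cutoff_def shell_slope_def by (intro continuous_intros)+

text \<open>The square is what makes the weight differentiable where it starts to vanish: at 0 the
  difference quotient lies between 0 and \<open>\<bar>y\<bar>\<close>.\<close>

lemma has_derivative_max_0_power2:
  "((\<lambda>u::real. (max 0 u)\<^sup>2) has_derivative (\<lambda>h. 2 * max 0 u * h)) (at u)"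
proof -
  consider "u > 0" | "u < 0" | "u = 0" by linarith
  then have "((\<lambda>u::real. (max 0 u)\<^sup>2) has_real_derivative 2 * max 0 u) (at u)"
  proof cases
    case 1
    have "((\<lambda>u::real. u\<^sup>2) has_real_derivative 2 * u) (at u)"
      by (auto intro!: derivative_eq_intros)
    from has_field_derivative_transform_within_open[OF this open_greaterThan[of 0]] 1
    show ?thesis by simp
  next
    case 2
    have "((\<lambda>u::real. 0) has_real_derivative 0) (at u)"
      by simp
    from has_field_derivative_transform_within_open[OF this open_lessThan[of 0]] 2
    show ?thesis by simp
  next
    case 3
    have "((\<lambda>y. (max 0 y)\<^sup>2 / y) \<longlongrightarrow> 0) (at (0::real))"
    proof (rule tendsto_sandwich)
      show "\<forall>\<^sub>F y in at 0. (0::real) \<le> (max 0 y)\<^sup>2 / y"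
        by (auto intro!: always_eventually simp: max_def)
      show "\<forall>\<^sub>F y in at (0::real). (max 0 y)\<^sup>2 / y \<le> \<bar>y\<bar>"
        by (auto intro!: always_eventually simp: max_def power2_eq_square)
      show "((\<lambda>y::real. \<bar>y\<bar>) \<longlongrightarrow> 0) (at 0)"
        by (rule tendsto_rabs_zero[OF tendsto_ident_at])
    qed simp
    then show ?thesis
      unfolding 3 has_field_derivative_iff by simp
  qed
  then show ?thesis
    by (simp add: has_field_derivative_def)
qed

lemma has_derivative_shell_cutoff:
  "(shell_cutoff has_derivative (\<lambda>v. shell_slope x * (x \<bullet> v))) (at x)"
proof -
  let ?u = "\<lambda>x::'a. ((norm x)\<^sup>2 - 1) * (4 - (norm x)\<^sup>2)"
  have "(?u has_derivative (\<lambda>v. 2 * (5 - 2 * (norm x)\<^sup>2) * (x \<bullet> v))) (at x)"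
    unfolding power2_norm_eq_inner
    by (auto intro!: derivative_eq_intros simp: algebra_simps inner_commute)
  from has_derivative_compose[OF this has_derivative_max_0_power2[of "?u x"]]
  show ?thesis
    by (simp add: shell_cutoff_def[abs_def] shell_slope_def mult.assoc)
qed

text \<open>In polar coordinates this is a positive constant times the surface integral of
  \<open>f\<close>. The value of \<open>sgn\<close> at 0 is masked by the weight, so only the values
  of \<open>f\<close> on the sphere enter.\<close>

definition sphere_int :: "(real^'n::finite \<Rightarrow> complex) \<Rightarrow> complex" where
  "sphere_int f = (\<integral>x. shell_cutoff x *\<^sub>R f (sgn x) \<partial>lborel)"

lemma continuous_on_vanishing_near_0:
  fixes h :: "'a::euclidean_space \<Rightarrow> real" and k :: "'a \<Rightarrow> 'b::real_normed_vector"
  assumes "continuous_on UNIV h" "\<And>x. norm x \<le> 1 \<Longrightarrow> h x = 0" "continuous_on (-{0}) k"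
  shows "continuous_on UNIV (\<lambda>x. h x *\<^sub>R k x)"
proof -
  have "continuous_on (-{0}) (\<lambda>x. h x *\<^sub>R k x)"
    by (intro continuous_intros continuous_on_subset[OF assms(1)] assms(3)) auto
  moreover have "continuous_on (ball 0 1) (\<lambda>x. h x *\<^sub>R k x)"
    using assms(2) by (intro continuous_on_eq[OF continuous_on_const[of _ 0]]) auto
  ultimately have "continuous_on (-{0} \<union> ball 0 1) (\<lambda>x. h x *\<^sub>R k x)"
    by (intro continuous_on_open_Un) auto
  moreover have "-{0} \<union> ball 0 1 = (UNIV::'a set)"
    by auto
  ultimately show ?thesis by simp
qed

lemma continuous_on_sgn: "continuous_on (-{0::'a::euclidean_space}) sgn"
  by (rule Ck_on_imp_continuous_on[OF Ck_on_sgn])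

lemma sphere_int_integrable:
  fixes f :: "real^'n \<Rightarrow> complex"
  assumes "continuous_on (sphere 0 1) f"
  shows "integrable lborel (\<lambda>x. shell_cutoff x *\<^sub>R f (sgn x))"
proof (rule integrable_compact_support[where r = 2])
  have "continuous_on (-{0}) (\<lambda>x. f (sgn x))"
    by (rule continuous_on_compose2[OF assms continuous_on_sgn]) (simp add: image_subset_iff norm_sgn)
  then show "continuous_on UNIV (\<lambda>x. shell_cutoff x *\<^sub>R f (sgn x))"
    by (intro continuous_on_vanishing_near_0 continuous_shell) (simp_all add: shell_outside)
qed (simp add: shell_outside)

lemma sphere_int_cong:
  assumes "\<And>x. norm x = 1 \<Longrightarrow> f x = g x"
  shows "sphere_int f = sphere_int g"
proof -
  have "shell_cutoff x *\<^sub>R f (sgn x) = shell_cutoff x *\<^sub>R g (sgn x)" for x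
    using assms[of "sgn x"] by (cases "x = 0") (simp_all add: norm_sgn shell_outside)
  then show ?thesis
    by (simp only: sphere_int_def)
qed

lemma sphere_int_add:
  assumes "continuous_on (sphere 0 1) f" "continuous_on (sphere 0 1) g"
  shows "sphere_int (\<lambda>x. f x + g x) = sphere_int f + sphere_int g"
  using sphere_int_integrable[OF assms(1)] sphere_int_integrable[OF assms(2)]
  by (simp add: sphere_int_def scaleR_add_right)

lemma sphere_int_cmult: "sphere_int (\<lambda>x. c * f x) = c * sphere_int f"
  by (simp add: sphere_int_def flip: mult_scaleR_right)

lemma sphere_int_diff:
  assumes "continuous_on (sphere 0 1) f" "continuous_on (sphere 0 1) g"
  shows "sphere_int (\<lambda>x. f x - g x) = sphere_int f - sphere_int g"
  using sphere_int_integrable[OF assms(1)] sphere_int_integrable[OF assms(2)]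
  by (simp add: sphere_int_def scaleR_diff_right)

lemma sphere_int_sum:
  assumes "\<And>i. i \<in> I \<Longrightarrow> continuous_on (sphere 0 1) (f i)"
  shows "sphere_int (\<lambda>x. \<Sum>i\<in>I. f i x) = (\<Sum>i\<in>I. sphere_int (f i))"
  using sphere_int_integrable[OF assms]
  by (simp add: sphere_int_def scaleR_sum_right)

lemma sphere_int_0 [simp]: "sphere_int (\<lambda>x. 0) = 0"
  by (simp add: sphere_int_def)

lemma sphere_int_norm_le:
  fixes f :: "real^'n \<Rightarrow> complex"
  assumes "continuous_on (sphere 0 1) f" "\<And>x. norm x = 1 \<Longrightarrow> norm (f x) \<le> B"
  shows "norm (sphere_int f) \<le> B * (\<integral>x. shell_cutoff (x::real^'n) \<partial>lborel)"
proof -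
  have "norm (sphere_int f) \<le> (\<integral>x. norm (shell_cutoff x *\<^sub>R f (sgn x)) \<partial>lborel)"
    unfolding sphere_int_def by (rule integral_norm_bound)
  also have "\<dots> \<le> (\<integral>x. B * shell_cutoff (x::real^'n) \<partial>lborel)"
  proof (rule integral_mono)
    show "integrable lborel (\<lambda>x. norm (shell_cutoff x *\<^sub>R f (sgn x)))"
      using sphere_int_integrable[OF assms(1)] by (rule integrable_norm)
    show "integrable lborel (\<lambda>x::real^'n. B * shell_cutoff x)"
      by (intro integrable_mult_right integrable_compact_support[where r = 2] continuous_shell)
        (simp add: shell_outside)
    show "norm (shell_cutoff x *\<^sub>R f (sgn x)) \<le> B * shell_cutoff x" for x
    proof (cases "x = 0")
      case False
      then show ?thesis
        using mult_right_mono[OF assms(2)[of "sgn x"] shell_cutoff_nonneg[of x]]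
        by (simp add: norm_sgn shell_cutoff_nonneg mult.commute)
    qed (simp add: shell_outside)
  qed
  finally show ?thesis by simp
qed

text \<open>Definiteness: the nonnegative integrand vanishes almost everywhere, but if
  \<open>f p\<close> were nonzero it would be positive on a nonempty open part of the shell, which
  is not a null set.\<close>

lemma sphere_int_norm_square_eq_0:
  fixes f :: "real^'n \<Rightarrow> complex"
  assumes "continuous_on (sphere 0 1) f" "sphere_int (\<lambda>x. f x * cnj (f x)) = 0" "norm p = 1"
  shows "f p = 0"
proof (rule ccontr)
  assume "f p \<noteq> 0"
  let ?h = "\<lambda>x. shell_cutoff x * (norm (f (sgn x)))\<^sup>2"
  have c: "continuous_on (sphere 0 1) (\<lambda>x. f x * cnj (f x))"
    by (intro continuous_intros assms(1))
  have e: "shell_cutoff x *\<^sub>R (f (sgn x) * cnj (f (sgn x))) = complex_of_real (?h x)" for x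
    by (simp only: of_real_mult complex_norm_square scaleR_conv_of_real)
  have "complex_of_real (\<integral>x. ?h x \<partial>lborel) = 0"
    using assms(2) unfolding sphere_int_def e by (simp only: integral_complex_of_real)
  moreover have "integrable lborel ?h"
    using integrable_Re[OF sphere_int_integrable[OF c, unfolded e]] by simp
  moreover have "AE x in lborel. 0 \<le> ?h x"
    by (rule AE_I2) (simp add: shell_cutoff_nonneg)
  ultimately have ae: "AE x in lborel. ?h x = 0"
    using integral_nonneg_eq_0_iff_AE[of lborel ?h] by (simp only: of_real_eq_0_iff)
  let ?S = "{x. norm x \<in> {1<..<2}} \<inter> (-{0} \<inter> (\<lambda>x. f (sgn x)) -` (-{0}))"
  have "continuous_on (-{0}) (\<lambda>x. f (sgn x))"
    by (rule continuous_on_compose2[OF assms(1) continuous_on_sgn]) (simp add: image_subset_iff norm_sgn)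
  then have "open (-{0} \<inter> (\<lambda>x. f (sgn x)) -` (-{0}))"
    by (rule continuous_open_preimage) auto
  moreover have "open {x::real^'n. norm x \<in> {1<..<2}}"
    using open_vimage[of "{1<..<2}" "norm :: real^'n \<Rightarrow> real"]
    by (simp add: vimage_def continuous_on_norm_id)
  ultimately have S: "open ?S" by (rule open_Int[rotated])
  \<comment> \<open>Any radius strictly between 1 and 2 would do.\<close>
  moreover have "(3/2) *\<^sub>R p \<in> ?S"
    using assms(3) \<open>f p \<noteq> 0\<close> by (auto simp: sgn_scaleR sgn_div_norm)
  ultimately have "\<not> negligible ?S"
    using open_not_negligible by blast
  moreover have "negligible ?S"
  proof -
    have "AE x in lborel. x \<notin> ?S"
    proof (rule AE_mp[OF ae], rule AE_I2, rule impI)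
      fix x assume "shell_cutoff x * (norm (f (sgn x)))\<^sup>2 = 0"
      then show "x \<notin> ?S"
        using shell_cutoff_pos[of x] by auto
    qed
    moreover have "?S \<in> sets lborel"
      unfolding sets_lborel by (rule borel_open[OF S])
    ultimately have "?S \<in> null_sets lborel"
      using AE_iff_null_sets by metis
    then show ?thesis
      unfolding negligible_iff_null_sets by (rule null_sets_completionI)
  qed
  ultimately show False by blast
qed

section \<open>Integration by parts for rotation fields\<close>

lemma rot_deriv_eq_frechet:
  assumes "f differentiable at x"
  shows "rot_deriv i j f x
    = frechet_derivative f (at x) ((x $ i) *\<^sub>R axis j 1 - (x $ j) *\<^sub>R axis i 1)"
proof -
  have l: "linear (frechet_derivative f (at x))"
    using assms linear_frechet_derivative by blast
  show ?thesis
    unfolding rot_deriv_def pd_def linear_diff[OF l] linear_cmul[OF l]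
    by (simp only: scaleR_conv_of_real)
qed

lemma has_derivative_sgn:
  fixes x :: "'a::euclidean_space"
  assumes "x \<noteq> 0"
  shows "(sgn has_derivative (\<lambda>v. inverse (norm x) *\<^sub>R v
    + (- (inverse (norm x) * (v \<bullet> sgn x) * inverse (norm x))) *\<^sub>R x)) (at x)"
proof -
  have "((\<lambda>x::'a. inverse (norm x) *\<^sub>R x) has_derivative (\<lambda>v. inverse (norm x) *\<^sub>R v
      + (- (inverse (norm x) * (v \<bullet> sgn x) * inverse (norm x))) *\<^sub>R x)) (at x)"
    by (rule has_derivative_scaleR[OF Deriv.has_derivative_inverse[OF _ has_derivative_norm]
          has_derivative_ident]) (use assms in auto)
  then show ?thesis
    by (simp add: sgn_div_norm[abs_def])
qed

text \<open>The rotation vector at \<open>x\<close> is orthogonal to \<open>x\<close>, which kills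
  the radial correction in the derivative of \<open>sgn\<close>, and it scales linearly with
  \<open>x\<close>, which cancels the remaining factor \<open>inverse (norm x)\<close>.\<close>

lemma rot_deriv_sgn:
  fixes f :: "real^'n \<Rightarrow> complex"
  assumes "Ck_on (Suc 0) (-{0}) f" "x \<noteq> 0"
  shows "rot_deriv i j f (sgn x) = rot_deriv i j (\<lambda>x. f (sgn x)) x"
proof -
  let ?a = "\<lambda>x::real^'n. (x $ i) *\<^sub>R axis j 1 - (x $ j) *\<^sub>R axis i 1"
  have x: "x \<in> -{0}" "sgn x \<in> -{0}" using assms(2) by (auto simp: sgn_zero_iff)
  let ?D = "frechet_derivative f (at (sgn x))"
  let ?r = "inverse (norm x)"
  have F: "(f has_derivative ?D) (at (sgn x))"
    by (rule Ck_on_has_derivative[OF assms(1) x(2)])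
  have C: "((\<lambda>x. f (sgn x)) has_derivative
      (\<lambda>v. ?D (?r *\<^sub>R v + (- (?r * (v \<bullet> sgn x) * ?r)) *\<^sub>R x))) (at x)"
    by (rule has_derivative_compose[OF has_derivative_sgn[OF assms(2)] F])
  have "?a x \<bullet> sgn x = 0"
    by (simp add: sgn_div_norm inner_diff_left inner_axis' )
  then have "?r *\<^sub>R ?a x + (- (?r * (?a x \<bullet> sgn x) * ?r)) *\<^sub>R x = ?a (sgn x)"
    by (simp add: sgn_div_norm scaleR_diff_right)
  moreover have "frechet_derivative (\<lambda>x. f (sgn x)) (at x)
      = (\<lambda>v. ?D (?r *\<^sub>R v + (- (?r * (v \<bullet> sgn x) * ?r)) *\<^sub>R x))"
    using frechet_derivative_at[OF C] by (rule sym)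
  ultimately show ?thesis
    using rot_deriv_eq_frechet[OF differentiableI[OF F], of i j]
      rot_deriv_eq_frechet[OF differentiableI[OF C], of i j] by simp
qed

text \<open>Since the weight \<open>w\<close> is radial, \<open>w (x\<^sub>i \<partial>\<^sub>j g - x\<^sub>j \<partial>\<^sub>i g) = \<partial>\<^sub>j (w x\<^sub>i g) - \<partial>\<^sub>i (w x\<^sub>j g)\<close>.\<close>

lemma sphere_int_rot_deriv:
  fixes f :: "real^'n \<Rightarrow> complex"
  assumes f: "Ck_on (Suc 0) (-{0}) f"
  shows "sphere_int (rot_deriv i j f) = 0"
proof -
  let ?g = "\<lambda>x. f (sgn x)"
  have g: "Ck_on (Suc 0) (-{0}) ?g"
    by (rule Ck_on_compose[OF open_punctured _ f Ck_on_sgn]) (auto simp: sgn_zero_iff)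
  define D where "D k x v = (shell_cutoff x * x $ k) *\<^sub>R frechet_derivative ?g (at x) v
      + (shell_cutoff x * v $ k + shell_slope x * (x \<bullet> v) * x $ k) *\<^sub>R ?g x" for k x v
  define F where "F k x = (shell_cutoff x * x $ k) *\<^sub>R ?g x" for k x
  have FD: "(F k has_derivative D k x) (at x)" for k x
  proof (cases "x = 0")
    case True
    have "((\<lambda>x. 0) has_derivative (\<lambda>v. 0)) (at x)" by simp
    moreover have "D k x = (\<lambda>v. 0)"
      by (simp add: D_def True shell_outside fun_eq_iff)
    ultimately show ?thesis
      by (intro has_derivative_transform_within_open[of "\<lambda>x. 0" _ _ _ "ball 0 1" "F k"])
        (simp_all add: F_def True shell_outside)
  next
    case False
    have "(?g has_derivative frechet_derivative ?g (at x)) (at x)"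
      using Ck_on_has_derivative[OF g] False by simp
    moreover have "((\<lambda>x. shell_cutoff x * x $ k) has_derivative
        (\<lambda>v. shell_cutoff x * v $ k + shell_slope x * (x \<bullet> v) * x $ k)) (at x)"
      by (rule has_derivative_mult[OF has_derivative_shell_cutoff
            bounded_linear_imp_has_derivative[OF bounded_linear_vec_nth]])
    ultimately show ?thesis
      unfolding F_def D_def by (intro has_derivative_scaleR)
  qed
  have gc: "continuous_on (-{0}) ?g"
    by (rule Ck_on_imp_continuous_on[OF g])
  have gc': "continuous_on (-{0}) (\<lambda>x. frechet_derivative ?g (at x) v)" for v
    by (rule Ck_on_imp_continuous_on[OF Ck_on_frechet[OF g]])
  have Dc: "continuous_on UNIV (\<lambda>x. D k x v)" for k v
    unfolding D_def
    by (intro continuous_on_add continuous_on_vanishing_near_0 gc gc' continuous_intros continuous_shell)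
      (simp_all add: shell_outside)
  have z: "F k x = 0" "D k x v = 0" if "2 \<le> norm x" for k x v
    using that by (simp_all add: F_def D_def shell_outside)
  note I = integral_directional_derivative_eq_0[OF FD Dc z]
  have "shell_cutoff x *\<^sub>R rot_deriv i j f (sgn x) = D i x (axis j 1) - D j x (axis i 1)" for x
  proof (cases "x = 0")
    case False
    \<comment> \<open>The terms in which the weight or a coordinate is differentiated are symmetric
      in \<open>i\<close> and \<open>j\<close>, so they cancel in the difference.\<close>
    have "(shell_cutoff x * axis j 1 $ i + shell_slope x * (x \<bullet> axis j 1) * x $ i)
        = (shell_cutoff x * axis i 1 $ j + shell_slope x * (x \<bullet> axis i 1) * x $ j)"
    proof -
      have "x \<bullet> axis k 1 = x $ k" for k
        by (simp add: inner_axis)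
      moreover have "axis j (1::real) $ i = axis i 1 $ j"
        by (auto simp: axis_def)
      ultimately show ?thesis by (simp add: mult.commute)
    qed
    then show ?thesis
      unfolding rot_deriv_sgn[OF f False]
      unfolding rot_deriv_def D_def pd_def
      by (simp add: scaleR_conv_of_real algebra_simps)
  qed (simp add: shell_outside D_def)
  then show ?thesis
    unfolding sphere_int_def using I by simp
qed

text \<open>Skew-symmetry: apply the product rule to \<open>f x * g x\<close> and use that a
  rotation derivative integrates to zero.\<close>

lemma sphere_int_rot_deriv_swap:
  fixes f g :: "real^'n \<Rightarrow> complex"
  assumes f: "Ck_on (Suc 0) (-{0}) f" and g: "Ck_on (Suc 0) (-{0}) g"
  shows "sphere_int (\<lambda>x. rot_deriv i j f x * g x) = - sphere_int (\<lambda>x. f x * rot_deriv i j g x)"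
proof -
  have s: "sphere 0 1 \<subseteq> -{0::real^'n}" by auto
  have c: "continuous_on (sphere 0 1) h" if "Ck_on k (-{0}) h" for h :: "real^'n \<Rightarrow> complex" and k
    using Ck_on_imp_continuous_on[OF that] continuous_on_subset s by blast
  note R = Ck_on_rot_deriv[OF open_punctured f] Ck_on_rot_deriv[OF open_punctured g]
  have "sphere_int (\<lambda>x. f x * rot_deriv i j g x) + sphere_int (\<lambda>x. rot_deriv i j f x * g x)
      = sphere_int (\<lambda>x. f x * rot_deriv i j g x + rot_deriv i j f x * g x)"
    by (intro sphere_int_add[symmetric] continuous_on_mult c[OF f] c[OF g] c[OF R(1)] c[OF R(2)])
  also have "\<dots> = sphere_int (rot_deriv i j (\<lambda>x. f x * g x))"
  proof (rule sphere_int_cong)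
    fix x :: "real^'n" assume "norm x = 1"
    then have "x \<in> -{0}" by auto
    then show "f x * rot_deriv i j g x + rot_deriv i j f x * g x = rot_deriv i j (\<lambda>x. f x * g x) x"
      using rot_deriv_mult[OF Ck_on_differentiable[OF f] Ck_on_differentiable[OF g]] by simp
  qed
  also have "\<dots> = 0"
    by (rule sphere_int_rot_deriv[OF Ck_on_mult[OF open_punctured f g]])
  finally show ?thesis
    by (simp add: eq_neg_iff_add_eq_0 add.commute)
qed

lemma Ck_on_imp_continuous_sphere:
  "Ck_on k (-{0}) f \<Longrightarrow> continuous_on (sphere 0 1) f"
  by (rule continuous_on_subset[OF Ck_on_imp_continuous_on]) auto

lemma sphere_int_sphere_laplacian_mult:
  fixes f :: "real^'n \<Rightarrow> complex"
  assumes "Ck_on (Suc (Suc 0)) (-{0}) f"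
  shows "2 * sphere_int (\<lambda>x. sphere_laplacian f x * h x)
    = sphere_int (\<lambda>x. \<Sum>i\<in>UNIV. \<Sum>j\<in>UNIV. rot_deriv i j (rot_deriv i j f) x * h x)"
  unfolding sphere_int_cmult[symmetric]
proof (rule sphere_int_cong)
  fix x :: "real^'n" assume "norm x = 1"
  then have "x \<in> -{0}" by auto
  from sum_rot_deriv_twice[OF assms this]
  have "2 * sphere_laplacian f x * h x
      = (\<Sum>i\<in>UNIV. \<Sum>j\<in>UNIV. rot_deriv i j (rot_deriv i j f) x) * h x"
    by simp
  then show "2 * (sphere_laplacian f x * h x)
      = (\<Sum>i\<in>UNIV. \<Sum>j\<in>UNIV. rot_deriv i j (rot_deriv i j f) x * h x)"
    by (simp only: sum_distrib_right mult.assoc)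
qed

lemma sphere_int_laplacian_symmetric:
  fixes f g :: "real^'n \<Rightarrow> complex"
  assumes f: "Ck_on (Suc (Suc 0)) (-{0}) f" and g: "Ck_on (Suc (Suc 0)) (-{0}) g"
  shows "sphere_int (\<lambda>x. sphere_laplacian f x * g x) = sphere_int (\<lambda>x. f x * sphere_laplacian g x)"
proof -
  have R: "Ck_on (Suc 0) (-{0}) (rot_deriv i j h)" "Ck_on 0 (-{0}) (rot_deriv i j (rot_deriv i j h))"
    if "Ck_on (Suc (Suc 0)) (-{0}) h" for i j and h :: "real^'n \<Rightarrow> complex"
    using Ck_on_rot_deriv[OF open_punctured that]
      Ck_on_rot_deriv[OF open_punctured Ck_on_rot_deriv[OF open_punctured that]] by simp_all
  have c: "continuous_on (sphere 0 1) (\<lambda>x. rot_deriv i j (rot_deriv i j h) x * k x)"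
    if "Ck_on (Suc (Suc 0)) (-{0}) h" "Ck_on (Suc (Suc 0)) (-{0}) k" for i j and h k :: "real^'n \<Rightarrow> complex"
    by (intro continuous_on_mult Ck_on_imp_continuous_sphere[OF R(2)[OF that(1)]]
        Ck_on_imp_continuous_sphere[OF that(2)])
  have S: "2 * sphere_int (\<lambda>x. sphere_laplacian h x * k x)
      = (\<Sum>i\<in>UNIV. \<Sum>j\<in>UNIV. sphere_int (\<lambda>x. rot_deriv i j (rot_deriv i j h) x * k x))"
    if "Ck_on (Suc (Suc 0)) (-{0}) h" "Ck_on (Suc (Suc 0)) (-{0}) k" for h k :: "real^'n \<Rightarrow> complex"
    unfolding sphere_int_sphere_laplacian_mult[OF that(1)]
    by (simp add: sphere_int_sum continuous_on_sum c[OF that])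
  \<comment> \<open>Both sides equal minus the integral of
    \<open>rot_deriv i j f x * rot_deriv i j g x\<close>.\<close>
  have "sphere_int (\<lambda>x. rot_deriv i j (rot_deriv i j f) x * g x)
      = sphere_int (\<lambda>x. rot_deriv i j (rot_deriv i j g) x * f x)" for i j
    using sphere_int_rot_deriv_swap[OF R(1)[OF f] Ck_on_SucD[OF g], of i j i j]
      sphere_int_rot_deriv_swap[OF R(1)[OF g] Ck_on_SucD[OF f], of i j i j]
    by (simp add: mult.commute)
  then have "2 * sphere_int (\<lambda>x. sphere_laplacian f x * g x)
      = 2 * sphere_int (\<lambda>x. sphere_laplacian g x * f x)"
    unfolding S[OF f g] S[OF g f] by simp
  then show ?thesis
    by (simp add: mult.commute)
qed

section \<open>Riemannian geometry of the sphere and of flat space\<close>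

lemma tangent_space_UNIV: "tangent_space UNIV (p::'a::euclidean_space) = UNIV"
proof -
  have "v \<in> tangent_space UNIV p" for v
  proof -
    have "((\<lambda>t. p + t *\<^sub>R v) has_vector_derivative v) (at 0)"
      by (auto intro!: derivative_eq_intros)
    then show ?thesis
      unfolding tangent_space_def mem_Collect_eq
      by (intro exI[of _ "\<lambda>t. p + t *\<^sub>R v"] exI[of _ 1]) simp
  qed
  then show ?thesis by auto
qed

lemma tangent_space_sphere:
  fixes p :: "'a::euclidean_space"
  assumes "norm p = 1"
  shows "tangent_space (sphere 0 1) p = {v. v \<bullet> p = 0}"
proof (intro equalityI subsetI)
  fix v assume "v \<in> tangent_space (sphere 0 1) p"
  then obtain \<gamma> \<epsilon> where \<gamma>: "\<epsilon> > 0" "\<And>t::real. \<bar>t\<bar> < \<epsilon> \<Longrightarrow> \<gamma> t \<in> sphere 0 1" "\<gamma> 0 = p"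
    "(\<gamma> has_vector_derivative v) (at 0)"
    unfolding tangent_space_def by auto
  have "((\<lambda>t. \<gamma> t \<bullet> \<gamma> t) has_derivative (\<lambda>h. \<gamma> 0 \<bullet> (h *\<^sub>R v) + (h *\<^sub>R v) \<bullet> \<gamma> 0)) (at 0)"
    using \<gamma>(4) unfolding has_vector_derivative_def by (intro has_derivative_inner)
  moreover have "((\<lambda>t. \<gamma> t \<bullet> \<gamma> t) has_derivative (\<lambda>h. 0)) (at 0)"
  proof (rule has_derivative_transform_within_open[of "\<lambda>t. 1" _ _ _ "{-\<epsilon><..<\<epsilon>}"])
    show "1 = \<gamma> t \<bullet> \<gamma> t" if "t \<in> {-\<epsilon><..<\<epsilon>}" for t
      using \<gamma>(2)[of t] that by (simp add: dot_square_norm abs_if)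
  qed (use \<gamma>(1) in auto)
  ultimately have "(\<lambda>h. \<gamma> 0 \<bullet> (h *\<^sub>R v) + (h *\<^sub>R v) \<bullet> \<gamma> 0) = (\<lambda>h. 0)"
    by (rule has_derivative_unique)
  then have "\<gamma> 0 \<bullet> (1 *\<^sub>R v) + (1 *\<^sub>R v) \<bullet> \<gamma> 0 = 0"
    by (rule fun_cong)
  then show "v \<in> {v. v \<bullet> p = 0}"
    by (simp add: \<gamma>(3) inner_commute)
next
  fix v assume "v \<in> {v. v \<bullet> p = 0}"
  then have v: "v \<bullet> p = 0" by simp
  \<comment> \<open>The tangent line projected to the sphere. It misses the origin, since
    \<open>p + t *\<^sub>R v\<close> has inner product 1 with \<open>p\<close>, and the derivative
    of \<open>sgn\<close> at \<open>p\<close> fixes the tangent vector \<open>v\<close>.\<close>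
  let ?\<gamma> = "\<lambda>t. sgn (p + t *\<^sub>R v)"
  have nz: "p + t *\<^sub>R v \<noteq> 0" for t
  proof
    assume "p + t *\<^sub>R v = 0"
    then have "(p + t *\<^sub>R v) \<bullet> p = 0" by simp
    then show False
      using v assms by (simp add: inner_add_left dot_square_norm)
  qed
  have p: "p \<noteq> 0" "sgn p = p" using assms by (auto simp: sgn_div_norm)
  have "((\<lambda>t. p + t *\<^sub>R v) has_derivative (\<lambda>h. h *\<^sub>R v)) (at 0)"
    by (auto intro!: derivative_eq_intros)
  from has_derivative_compose[OF this, of sgn "\<lambda>v. v - (v \<bullet> p) *\<^sub>R p"] has_derivative_sgn[OF p(1)]
  have "(?\<gamma> has_vector_derivative v) (at 0)"
    unfolding has_vector_derivative_def by (simp add: assms p(2) v)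
  then show "v \<in> tangent_space (sphere 0 1) p"
    unfolding tangent_space_def mem_Collect_eq
    by (intro exI[of _ ?\<gamma>] exI[of _ 1]) (simp add: norm_sgn nz p(2))
qed

text \<open>Derivatives within \<open>M\<close> may differ in normal directions. Composing with a
  curve in \<open>M\<close> of velocity \<open>v\<close> reduces to a derivative on an open
  interval, where uniqueness holds.\<close>

lemma frechet_derivative_within_tangent:
  assumes f': "(f has_derivative f') (at p within M)" and v: "v \<in> tangent_space M p"
  shows "frechet_derivative f (at p within M) v = f' v"
proof -
  obtain \<gamma> \<epsilon> where \<gamma>: "\<epsilon> > 0" "\<And>t::real. \<bar>t\<bar> < \<epsilon> \<Longrightarrow> \<gamma> t \<in> M" "\<gamma> 0 = p"
    "(\<gamma> has_vector_derivative v) (at 0)"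
    using v unfolding tangent_space_def by auto
  let ?S = "{-\<epsilon><..<\<epsilon>}"
  have S: "\<gamma> ` ?S \<subseteq> M" "0 \<in> ?S" using \<gamma>(1,2) by (auto simp: abs_less_iff)
  have g: "(\<gamma> has_derivative (\<lambda>h. h *\<^sub>R v)) (at 0 within ?S)"
    using \<gamma>(4) has_derivative_at_withinI unfolding has_vector_derivative_def by blast
  have *: "((\<lambda>t. f (\<gamma> t)) has_derivative (\<lambda>h. D (h *\<^sub>R v))) (at 0)"
    if "(f has_derivative D) (at p within M)" for D
  proof -
    have "(f has_derivative D) (at (\<gamma> 0) within \<gamma> ` ?S)"
      using has_derivative_subset[OF that S(1)] \<gamma>(3) by simp
    from has_derivative_in_compose[OF g this] show ?thesis
      using at_within_open[OF S(2) open_greaterThanLessThan] by simp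
  qed
  have "(f has_derivative frechet_derivative f (at p within M)) (at p within M)"
    using differentiableI[OF f'] frechet_derivative_works by blast
  from has_derivative_unique[OF *[OF this] *[OF f']]
  have "frechet_derivative f (at p within M) (1 *\<^sub>R v) = f' (1 *\<^sub>R v)"
    by (rule fun_cong)
  then show ?thesis by simp
qed

lemma gradient_eqI:
  assumes T: "subspace (tangent_space M p)" and f': "(f has_derivative f') (at p within M)"
    and w: "w \<in> tangent_space M p" "\<And>v. v \<in> tangent_space M p \<Longrightarrow> w \<bullet> v = f' v"
  shows "gradient M f p = w"
  unfolding gradient_def
proof (rule the_equality)
  show "w \<in> tangent_space M p \<and>
      (\<forall>v\<in>tangent_space M p. w \<bullet> v = frechet_derivative f (at p within M) v)"
    using w by (auto simp: frechet_derivative_within_tangent[OF f'])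
next
  fix u assume u: "u \<in> tangent_space M p \<and>
      (\<forall>v\<in>tangent_space M p. u \<bullet> v = frechet_derivative f (at p within M) v)"
  then have "u - w \<in> tangent_space M p"
    using T w(1) by (intro subspace_diff) auto
  then have "u \<bullet> (u - w) = w \<bullet> (u - w)"
    using u w(2) by (simp add: frechet_derivative_within_tangent[OF f'])
  then show "u = w"
    by (metis cancel_comm_monoid_add_class.diff_cancel eq_iff_diff_eq_0 inner_diff_left inner_eq_zero_iff)
qed

lemma orthogonal_projection_inner:
  fixes T :: "'a::euclidean_space set"
  assumes T: "subspace T" and b: "b \<in> T"
  shows "orthogonal_projection T x \<bullet> b = x \<bullet> b"
proof -
  have "\<exists>!w. w \<in> T \<and> (\<forall>u\<in>T. (x - w) \<bullet> u = 0)"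
  proof (rule ex_ex1I)
    obtain y z where "y \<in> span T" "\<And>w. w \<in> span T \<Longrightarrow> orthogonal z w" "x = y + z"
      using orthogonal_subspace_decomp_exists by metis
    then show "\<exists>w. w \<in> T \<and> (\<forall>u\<in>T. (x - w) \<bullet> u = 0)"
      using T[folded span_eq_iff] by (intro exI[of _ y]) (simp add: orthogonal_def)
  next
    fix w u assume wu: "w \<in> T \<and> (\<forall>u\<in>T. (x - w) \<bullet> u = 0)" "u \<in> T \<and> (\<forall>v\<in>T. (x - u) \<bullet> v = 0)"
    then have "u - w \<in> T" using T by (intro subspace_diff) auto
    then have "(x - w) \<bullet> (u - w) = 0" "(x - u) \<bullet> (u - w) = 0"
      using wu by auto
    then have "(u - w) \<bullet> (u - w) = 0"
      by (simp add: inner_diff_left inner_diff_right)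
    then show "w = u" by simp
  qed
  from theI'[OF this] have "(x - orthogonal_projection T x) \<bullet> b = 0"
    using b unfolding orthogonal_projection_def by blast
  then show ?thesis by (simp add: inner_diff_left)
qed

text \<open>Pairing with tangent basis vectors makes the projection in the covariant derivative
  invisible. The basis is the one picked by \<open>SOME\<close> in \<open>trace_on\<close>, so all
  that is known about it is its orthonormality.\<close>

lemma divergence_eq:
  assumes T: "subspace (tangent_space M p)" and X: "(X has_derivative X') (at p within M)"
  obtains B where "orthonormal_basis_of (tangent_space M p) B"
    "divergence M X p = (\<Sum>b\<in>B. X' b \<bullet> b)"
proof
  let ?T = "tangent_space M p"
  define B where "B = (SOME B. orthonormal_basis_of ?T B)"
  obtain B' where "B' \<subseteq> ?T" "pairwise orthogonal B'" "\<And>x. x \<in> B' \<Longrightarrow> norm x = 1" "span B' = ?T"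
    using orthonormal_basis_subspace[OF T] by metis
  then have "orthonormal_basis_of ?T B'"
    unfolding orthonormal_basis_of_def by blast
  then show B: "orthonormal_basis_of ?T B"
    unfolding B_def by (rule someI)
  then have "B \<subseteq> ?T"
    unfolding orthonormal_basis_of_def using span_superset by metis
  then have "covariant_derivative M X p b \<bullet> b = X' b \<bullet> b" if "b \<in> B" for b
    using that frechet_derivative_within_tangent[OF X] orthogonal_projection_inner[OF T]
    unfolding covariant_derivative_def by (metis subsetD)
  then show "divergence M X p = (\<Sum>b\<in>B. X' b \<bullet> b)"
    unfolding divergence_def trace_on_def B_def[symmetric] by (rule sum.cong[OF refl])
qed

section \<open>Traces over orthonormal bases\<close>

lemma orthonormal_finite:
  fixes B :: "'a::euclidean_space set"
  assumes "pairwise orthogonal B" "\<And>b. b \<in> B \<Longrightarrow> norm b = 1"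
  shows "finite B"
proof -
  have "0 \<notin> B" using assms(2)[of 0] by auto
  then show ?thesis
    using pairwise_orthogonal_independent[OF assms(1)] independent_imp_finite by blast
qed

text \<open>Basis independence: expand each \<open>b\<close> along \<open>Basis\<close>, exchange
  the sums, and recognise the expansion of each \<open>i\<close> along \<open>B\<close>.\<close>

lemma trace_orthonormal_basis:
  fixes h :: "'a::euclidean_space \<Rightarrow> 'a"
  assumes h: "linear h" and B: "orthonormal_basis_of UNIV B"
  shows "(\<Sum>b\<in>B. h b \<bullet> b) = (\<Sum>i\<in>Basis. h i \<bullet> i)"
proof -
  have o: "pairwise orthogonal B" "\<And>b. b \<in> B \<Longrightarrow> norm b = 1" "span B = UNIV"
    using B unfolding orthonormal_basis_of_def by auto
  have fin: "finite B" by (rule orthonormal_finite[OF o(1,2)])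
  have "h b \<bullet> b = (\<Sum>i\<in>Basis. (b \<bullet> i) * (h i \<bullet> b))" for b
  proof -
    have "h b = h (\<Sum>i\<in>Basis. (b \<bullet> i) *\<^sub>R i)"
      by (simp only: euclidean_representation)
    also have "\<dots> = (\<Sum>i\<in>Basis. (b \<bullet> i) *\<^sub>R h i)"
      by (simp only: linear_sum[OF h] linear_cmul[OF h])
    finally have "h b \<bullet> b = (\<Sum>i\<in>Basis. (b \<bullet> i) *\<^sub>R h i) \<bullet> b" by simp
    then show ?thesis by (simp add: inner_sum_left)
  qed
  then have "(\<Sum>b\<in>B. h b \<bullet> b) = (\<Sum>i\<in>Basis. \<Sum>b\<in>B. (b \<bullet> i) * (h i \<bullet> b))"
    by (simp only: sum.swap[of _ Basis B])
  also have "\<dots> = (\<Sum>i\<in>Basis. h i \<bullet> i)"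
  proof (rule sum.cong[OF refl])
    fix i :: 'a
    have "(\<Sum>b\<in>B. (i \<bullet> b) *\<^sub>R b) = i"
      by (rule orthonormal_basis_expand[OF o(1,2) _ fin]) (simp_all add: o(3))
    then have "h i \<bullet> i = h i \<bullet> (\<Sum>b\<in>B. (i \<bullet> b) *\<^sub>R b)" by simp
    then show "(\<Sum>b\<in>B. (b \<bullet> i) * (h i \<bullet> b)) = h i \<bullet> i"
      by (simp add: inner_sum_right inner_commute[of i])
  qed
  finally show ?thesis .
qed

text \<open>Lets a trace over the tangent space of the sphere be computed as a full trace minus its
  normal term.\<close>

lemma orthonormal_basis_insert_normal:
  fixes p :: "'a::euclidean_space"
  assumes "norm p = 1" "orthonormal_basis_of {v. v \<bullet> p = 0} B"
  shows "orthonormal_basis_of UNIV (insert p B)" "p \<notin> B" "finite B"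
proof -
  have o: "pairwise orthogonal B" "\<And>b. b \<in> B \<Longrightarrow> norm b = 1" "span B = {v. v \<bullet> p = 0}"
    using assms(2) unfolding orthonormal_basis_of_def by auto
  have op: "b \<bullet> p = 0" if "b \<in> B" for b
    using span_base[OF that] o(3) by simp
  show "p \<notin> B"
    using op[of p] assms(1) by (auto simp: dot_square_norm)
  show "finite B" by (rule orthonormal_finite[OF o(1,2)])
  have "x \<in> span (insert p B)" for x
  proof -
    have "x - (x \<bullet> p) *\<^sub>R p \<in> span B"
      unfolding o(3) using assms(1) by (simp add: inner_diff_left dot_square_norm)
    then show ?thesis
      unfolding span_insert by blast
  qed
  moreover have "pairwise orthogonal (insert p B)"
    using o(1) op by (auto simp: pairwise_insert orthogonal_def inner_commute)
  ultimately show "orthonormal_basis_of UNIV (insert p B)"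
    unfolding orthonormal_basis_of_def using o(2) assms(1) by auto
qed

text \<open>\<open>L\<close> will be \<open>Re\<close> or \<open>Im\<close>; a general real-linear
  \<open>L\<close> treats both real components of a complex function at once.\<close>

definition component_gradient :: "(complex \<Rightarrow> real) \<Rightarrow> (real^'n::finite \<Rightarrow> complex) \<Rightarrow> real^'n \<Rightarrow> real^'n" where
  "component_gradient L \<phi> x = (\<chi> i. L (pd i \<phi> x))"

lemma bounded_linear_of_real_mult:
  fixes L :: "complex \<Rightarrow> real"
  assumes "bounded_linear L"
  shows "L (of_real c * z) = c * L z"
  using linear_cmul[OF bounded_linear.linear[OF assms], of c z] by (simp add: scaleR_conv_of_real)

lemma component_has_derivative:
  assumes L: "bounded_linear L" and \<phi>: "\<phi> differentiable at x"
  shows "((\<lambda>x. L (\<phi> x)) has_derivative (\<lambda>v. component_gradient L \<phi> x \<bullet> v)) (at x)"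
proof -
  have "L (frechet_derivative \<phi> (at x) v) = component_gradient L \<phi> x \<bullet> v" for v
    by (simp add: frechet_derivative_eq_pd[OF \<phi>] linear_sum[OF bounded_linear.linear[OF L]]
        bounded_linear_of_real_mult[OF L] component_gradient_def inner_vec_def)
      (simp add: mult.commute)
  then show ?thesis
    using bounded_linear.has_derivative[OF L \<phi>[unfolded frechet_derivative_works]] by simp
qed

definition component_hessian :: "(complex \<Rightarrow> real) \<Rightarrow> (real^'n::finite \<Rightarrow> complex) \<Rightarrow> real^'n \<Rightarrow> real^'n \<Rightarrow> real^'n" where
  "component_hessian L \<phi> x v = (\<chi> i. L (\<Sum>j\<in>UNIV. of_real (v $ j) * pd j (pd i \<phi>) x))"

lemma component_gradient_has_derivative:
  assumes L: "bounded_linear L" and \<phi>: "\<And>i. pd i \<phi> differentiable at x"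
  shows "(component_gradient L \<phi> has_derivative component_hessian L \<phi> x) (at x)"
proof -
  have "((\<lambda>x. L (pd i \<phi> x)) has_derivative (\<lambda>v. L (\<Sum>j\<in>UNIV. of_real (v $ j) * pd j (pd i \<phi>) x))) (at x)" for i
    using bounded_linear.has_derivative[OF L \<phi>[of i, unfolded frechet_derivative_works]]
    by (simp add: frechet_derivative_eq_pd[OF \<phi>])
  then have "((\<lambda>x. component_gradient L \<phi> x $ i) has_derivative (\<lambda>v. component_hessian L \<phi> x v $ i)) (at x)" for i
    by (simp add: component_gradient_def component_hessian_def)
  then show ?thesis
    unfolding has_derivative_componentwise_within[of "component_gradient L \<phi>"]
    by (auto simp: Basis_vec_def inner_axis)
qed

lemma component_hessian_trace:
  assumes L: "bounded_linear L"
  shows "(\<Sum>i\<in>Basis. component_hessian L \<phi> x i \<bullet> i) = L (laplacian \<phi> x)"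
proof -
  have "(\<Sum>i\<in>Basis. component_hessian L \<phi> x i \<bullet> i)
      = (\<Sum>k\<in>UNIV. component_hessian L \<phi> x (axis k 1) \<bullet> axis k 1)"
  proof (rule sum.reindex_cong[of "\<lambda>k. axis k (1::real)"])
    show "inj (\<lambda>k. axis k (1::real))"
      by (rule injI) (simp add: axis_eq_axis)
  qed (auto simp: Basis_vec_def)
  also have "\<dots> = (\<Sum>k\<in>UNIV. L (pd k (pd k \<phi>) x))"
  proof (rule sum.cong[OF refl])
    fix k
    have "(\<Sum>j\<in>UNIV. of_real (axis k 1 $ j) * pd j (pd k \<phi>) x) = pd k (pd k \<phi>) x"
      by (simp add: axis_def if_distrib[where f = of_real] if_distrib[where f = "\<lambda>a. a * b" for b]
          cong: if_cong)
    then show "component_hessian L \<phi> x (axis k 1) \<bullet> axis k 1 = L (pd k (pd k \<phi>) x)"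
      by (simp add: component_hessian_def inner_axis)
  qed
  finally show ?thesis
    by (simp add: laplacian_def linear_sum[OF bounded_linear.linear[OF L]])
qed

lemma component_hessian_radial:
  assumes L: "bounded_linear L"
  shows "component_hessian L \<phi> x x \<bullet> x = L (radial_deriv2 \<phi> x)"
proof -
  have "component_hessian L \<phi> x x \<bullet> x
      = (\<Sum>i\<in>UNIV. (x $ i) *\<^sub>R L (\<Sum>j\<in>UNIV. of_real (x $ j) * pd j (pd i \<phi>) x))"
    by (simp add: component_hessian_def inner_vec_def mult.commute)
  also have "\<dots> = L (\<Sum>i\<in>UNIV. (x $ i) *\<^sub>R (\<Sum>j\<in>UNIV. of_real (x $ j) * pd j (pd i \<phi>) x))"
    by (simp only: linear_sum[OF bounded_linear.linear[OF L]] linear_cmul[OF bounded_linear.linear[OF L]])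
  also have "(\<Sum>i\<in>UNIV. (x $ i) *\<^sub>R (\<Sum>j\<in>UNIV. of_real (x $ j) * pd j (pd i \<phi>) x)) = radial_deriv2 \<phi> x"
    by (simp add: radial_deriv2_def scaleR_conv_of_real sum_distrib_left mult.assoc)
  finally show ?thesis .
qed

lemma component_gradient_radial:
  assumes L: "bounded_linear L"
  shows "component_gradient L \<phi> x \<bullet> x = L (radial_deriv \<phi> x)"
  by (simp add: component_gradient_def inner_vec_def radial_deriv_def
      linear_sum[OF bounded_linear.linear[OF L]] bounded_linear_of_real_mult[OF L])
    (simp add: mult.commute)

section \<open>Gradients and Laplace-Beltrami operators of flat space and of the sphere\<close>

lemma gradient_UNIV:
  assumes "bounded_linear L" "\<phi> differentiable at x"
  shows "gradient UNIV (\<lambda>x. L (\<phi> x)) x = component_gradient L \<phi> x"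
  by (rule gradient_eqI[OF _ component_has_derivative[OF assms]]) (simp_all add: tangent_space_UNIV)

lemma laplace_beltrami_UNIV:
  assumes L: "bounded_linear L" and \<phi>: "Ck_on (Suc (Suc 0)) UNIV \<phi>"
  shows "laplace_beltrami UNIV (\<lambda>x. L (\<phi> x)) p = L (laplacian \<phi> p)"
proof -
  have G: "gradient UNIV (\<lambda>x. L (\<phi> x)) = component_gradient L \<phi>"
    by (rule ext, rule gradient_UNIV[OF L Ck_on_differentiable[OF \<phi>]]) simp
  have D: "(component_gradient L \<phi> has_derivative component_hessian L \<phi> p) (at p)"
    by (rule component_gradient_has_derivative[OF L Ck_on_differentiable[OF Ck_on_pd[OF \<phi>]]]) simp
  obtain B where "orthonormal_basis_of UNIV B"
    "divergence UNIV (component_gradient L \<phi>) p = (\<Sum>b\<in>B. component_hessian L \<phi> p b \<bullet> b)"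
    by (rule divergence_eq[OF _ D]) (simp_all add: tangent_space_UNIV)
  then show ?thesis
    using trace_orthonormal_basis[OF has_derivative_linear[OF D]] component_hessian_trace[OF L]
    by (simp add: laplace_beltrami_def G)
qed

lemma subspace_tangent_sphere: "subspace {v::'a::euclidean_space. v \<bullet> p = 0}"
  by (simp add: subspace_def inner_add_left)

lemma gradient_sphere:
  fixes \<phi> :: "real^'n \<Rightarrow> complex"
  assumes L: "bounded_linear L" and \<phi>: "\<phi> differentiable at p" and p: "norm p = 1"
    and f: "\<And>x. norm x = 1 \<Longrightarrow> f x = L (\<phi> x)"
  shows "gradient (sphere 0 1) f p
    = component_gradient L \<phi> p - (component_gradient L \<phi> p \<bullet> p) *\<^sub>R p"
proof (rule gradient_eqI)
  show "(f has_derivative (\<lambda>v. component_gradient L \<phi> p \<bullet> v)) (at p within sphere 0 1)"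
    by (rule has_derivative_transform[OF _ _ has_derivative_at_withinI[OF component_has_derivative[OF L \<phi>]]])
      (use p f in auto)
qed (simp_all add: tangent_space_sphere[OF p] subspace_tangent_sphere inner_diff_left
    inner_commute[of p] dot_square_norm p)

lemma laplace_beltrami_sphere:
  fixes \<phi> :: "real^'n \<Rightarrow> complex"
  assumes L: "bounded_linear L" and \<phi>: "Ck_on (Suc (Suc 0)) (-{0}) \<phi>" and p: "norm p = 1"
    and f: "\<And>x. norm x = 1 \<Longrightarrow> f x = L (\<phi> x)"
  shows "laplace_beltrami (sphere 0 1) f p = L (sphere_laplacian \<phi> p)"
proof -
  let ?G = "component_gradient L \<phi>" and ?H = "component_hessian L \<phi> p"
  have p0: "p \<in> -{0}" using p by auto
  have D: "(?G has_derivative ?H) (at p)"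
    by (rule component_gradient_has_derivative[OF L Ck_on_differentiable[OF Ck_on_pd[OF \<phi>] p0]])
  \<comment> \<open>Product rule for the tangential part of \<open>?G\<close>, which extends the
    gradient field off the sphere.\<close>
  let ?X' = "\<lambda>v. ?H v - ((?G p \<bullet> p) *\<^sub>R v + (?G p \<bullet> v + ?H v \<bullet> p) *\<^sub>R p)"
  have "((\<lambda>x. ?G x - (?G x \<bullet> x) *\<^sub>R x) has_derivative ?X') (at p)"
    by (intro has_derivative_diff D has_derivative_scaleR has_derivative_inner has_derivative_ident)
  then have X: "(gradient (sphere 0 1) f has_derivative ?X') (at p within sphere 0 1)"
  proof (rule has_derivative_transform[OF _ _ has_derivative_at_withinI, rotated 2])
    show "gradient (sphere 0 1) f x = ?G x - (?G x \<bullet> x) *\<^sub>R x" if "x \<in> sphere 0 1" for x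
      by (rule gradient_sphere[OF L Ck_on_differentiable[OF \<phi>] _ f]) (use that in auto)
  qed (simp add: p)
  obtain B where B: "orthonormal_basis_of {v. v \<bullet> p = 0} B"
    "divergence (sphere 0 1) (gradient (sphere 0 1) f) p = (\<Sum>b\<in>B. ?X' b \<bullet> b)"
    by (rule divergence_eq[OF _ X, unfolded tangent_space_sphere[OF p], OF subspace_tangent_sphere])
  note N = orthonormal_basis_insert_normal[OF p B(1)]
  have b: "b \<bullet> p = 0" "norm b = 1" if "b \<in> B" for b
    using B(1) span_base[OF that] that unfolding orthonormal_basis_of_def by auto
  \<comment> \<open>The multiple of \<open>p\<close> is orthogonal to \<open>b\<close>. The normal
    component \<open>?G p \<bullet> p\<close> enters through the curvature of the sphere, once for
    each unit tangent vector.\<close>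
  have "?X' b \<bullet> b = ?H b \<bullet> b - ?G p \<bullet> p" if "b \<in> B" for b
    using b[OF that] by (simp add: inner_diff_left inner_add_left inner_commute[of p b] dot_square_norm)
  then have "(\<Sum>b\<in>B. ?X' b \<bullet> b) = (\<Sum>b\<in>B. ?H b \<bullet> b) - real (card B) * (?G p \<bullet> p)"
    by (simp add: sum_subtractf)
  also have "(\<Sum>b\<in>B. ?H b \<bullet> b) = L (laplacian \<phi> p) - L (radial_deriv2 \<phi> p)"
    using trace_orthonormal_basis[OF has_derivative_linear[OF D] N(1)] N(2,3)
      component_hessian_trace[OF L, of \<phi> p] component_hessian_radial[OF L, of \<phi> p] by simp
  also have "real (card B) = real CARD('n) - 1"
  proof -
    \<comment> \<open>The dimension is read off as the trace of the identity.\<close>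
    have "(\<Sum>b\<in>insert p B. id b \<bullet> b) = (\<Sum>b\<in>insert p B. 1)"
      by (rule sum.cong[OF refl]) (use b(2) p in \<open>auto simp: dot_square_norm\<close>)
    moreover have "(\<Sum>b\<in>insert p B. id b \<bullet> b) = (\<Sum>i\<in>(Basis::(real^'n) set). id i \<bullet> i)"
      by (rule trace_orthonormal_basis[OF linear_id N(1)])
    moreover have "(\<Sum>i\<in>(Basis::(real^'n) set). id i \<bullet> i) = real CARD('n)"
      by (simp add: inner_Basis)
    ultimately show ?thesis
      using N(2,3) by simp
  qed
  finally show ?thesis
    unfolding laplace_beltrami_def B(2) component_gradient_radial[OF L] sphere_laplacian_def p
      linear_diff[OF bounded_linear.linear[OF L]] bounded_linear_of_real_mult[OF L] by simp
qed

lemma claplace_beltrami_sphere: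
  assumes "Ck_on (Suc (Suc 0)) (-{0}) \<phi>" "norm p = 1" "\<And>x. norm x = 1 \<Longrightarrow> f x = \<phi> x"
  shows "claplace_beltrami (sphere 0 1) f p = sphere_laplacian \<phi> p"
  unfolding claplace_beltrami_def
  using laplace_beltrami_sphere[OF bounded_linear_Re assms(1,2), of "\<lambda>x. Re (f x)"]
    laplace_beltrami_sphere[OF bounded_linear_Im assms(1,2), of "\<lambda>x. Im (f x)"] assms(3)
  by simp

lemma claplace_beltrami_UNIV:
  assumes "Ck_on (Suc (Suc 0)) UNIV \<phi>"
  shows "claplace_beltrami UNIV \<phi> p = laplacian \<phi> p"
  unfolding claplace_beltrami_def
  using laplace_beltrami_UNIV[OF bounded_linear_Re assms] laplace_beltrami_UNIV[OF bounded_linear_Im assms]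
  by simp

lemma cmetric_component:
  fixes a b :: "'n::finite \<Rightarrow> complex"
  shows "cmetric (\<chi> i. Re (a i), \<chi> i. Im (a i)) (\<chi> i. Re (b i), \<chi> i. Im (b i)) = (\<Sum>i\<in>UNIV. a i * b i)"
  by (rule complex_eqI) (simp_all add: cmetric_def inner_vec_def sum_subtractf sum.distrib)

lemma cmetric_cgradient_UNIV:
  assumes "\<phi> differentiable at p" "\<psi> differentiable at p"
  shows "cmetric (cgradient UNIV \<phi> p) (cgradient UNIV \<psi> p) = grad_prod \<phi> \<psi> p"
  unfolding cgradient_def gradient_UNIV[OF bounded_linear_Re assms(1)]
    gradient_UNIV[OF bounded_linear_Im assms(1)] gradient_UNIV[OF bounded_linear_Re assms(2)]
    gradient_UNIV[OF bounded_linear_Im assms(2)] component_gradient_def cmetric_component grad_prod_def ..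

lemma cgradient_sphere:
  fixes \<phi> :: "real^'n \<Rightarrow> complex"
  assumes "\<phi> differentiable at p" "norm p = 1" "\<And>x. norm x = 1 \<Longrightarrow> f x = \<phi> x"
  shows "cgradient (sphere 0 1) f p
    = (\<chi> i. Re (pd i \<phi> p - radial_deriv \<phi> p * of_real (p $ i)),
       \<chi> i. Im (pd i \<phi> p - radial_deriv \<phi> p * of_real (p $ i)))"
proof -
  have "gradient (sphere 0 1) (\<lambda>x. L (f x)) p = (\<chi> i. L (pd i \<phi> p - radial_deriv \<phi> p * of_real (p $ i)))"
    if L: "bounded_linear L" for L :: "complex \<Rightarrow> real"
  proof -
    have "L (radial_deriv \<phi> p * of_real (p $ i)) = L (radial_deriv \<phi> p) * p $ i" for i
      using linear_cmul[OF bounded_linear.linear[OF L], of "p $ i" "radial_deriv \<phi> p"]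
      by (simp add: scaleR_conv_of_real mult.commute)
    then show ?thesis
      using gradient_sphere[OF L assms(1,2), of "\<lambda>x. L (f x)", unfolded component_gradient_radial[OF L]]
        assms(3)
      by (simp add: vec_eq_iff component_gradient_def linear_diff[OF bounded_linear.linear[OF L]])
  qed
  then show ?thesis
    unfolding cgradient_def using bounded_linear_Re bounded_linear_Im by simp
qed

text \<open>Removing the components along the unit normal \<open>p\<close> from both complex
  gradients subtracts the product of these components, here for a bilinear form instead of an inner
  product.\<close>

lemma cmetric_cgradient_sphere:
  fixes \<phi> \<psi> :: "real^'n \<Rightarrow> complex"
  assumes "\<phi> differentiable at p" "\<psi> differentiable at p" "norm p = 1"
    "\<And>x. norm x = 1 \<Longrightarrow> f x = \<phi> x" "\<And>x. norm x = 1 \<Longrightarrow> g x = \<psi> x"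
  shows "cmetric (cgradient (sphere 0 1) f p) (cgradient (sphere 0 1) g p)
    = grad_prod \<phi> \<psi> p - radial_deriv \<phi> p * radial_deriv \<psi> p"
proof -
  let ?x = "\<lambda>i. complex_of_real (p $ i)" and ?a = "radial_deriv \<phi> p" and ?b = "radial_deriv \<psi> p"
  have "(\<Sum>i\<in>UNIV. (pd i \<phi> p - ?a * ?x i) * (pd i \<psi> p - ?b * ?x i))
      = (\<Sum>i\<in>UNIV. pd i \<phi> p * pd i \<psi> p) - ?b * (\<Sum>i\<in>UNIV. ?x i * pd i \<phi> p)
        - ?a * (\<Sum>i\<in>UNIV. ?x i * pd i \<psi> p) + ?a * ?b * (\<Sum>i\<in>UNIV. ?x i * ?x i)"
    unfolding sum_distrib_left sum_subtractf[symmetric] sum.distrib[symmetric]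
    by (rule sum.cong[OF refl]) (simp add: algebra_simps)
  also have "\<dots> = grad_prod \<phi> \<psi> p - ?a * ?b"
    unfolding sum_coord_square assms(3) grad_prod_def[symmetric] radial_deriv_def[symmetric]
    by (simp add: mult.commute)
  finally show ?thesis
    by (simp only: cgradient_sphere[OF assms(1,3,4)] cgradient_sphere[OF assms(2,3,5)]
        cmetric_component)
qed

section \<open>The spectrum of the sphere\<close>

text \<open>Hermitian, because Gram-Schmidt needs definiteness. Moments elsewhere are bilinear;
  \<open>hpoly_cnj\<close> allows passing from one to the other.\<close>

definition sphere_inner :: "(real^'n::finite \<Rightarrow> complex) \<Rightarrow> (real^'n \<Rightarrow> complex) \<Rightarrow> complex" where
  "sphere_inner f g = sphere_int (\<lambda>x. f x * cnj (g x))"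

context
  fixes f g h :: "real^'n::finite \<Rightarrow> complex"
  assumes c: "continuous_on (sphere 0 1) f" "continuous_on (sphere 0 1) g" "continuous_on (sphere 0 1) h"
begin

lemma sphere_inner_diff_left:
  "sphere_inner (\<lambda>x. f x - g x) h = sphere_inner f h - sphere_inner g h"
  unfolding sphere_inner_def left_diff_distrib
  by (intro sphere_int_diff continuous_intros c)

lemma sphere_inner_add_right:
  "sphere_inner f (\<lambda>x. g x + h x) = sphere_inner f g + sphere_inner f h"
  unfolding sphere_inner_def complex_cnj_add distrib_left
  by (intro sphere_int_add continuous_intros c)

lemma sphere_inner_diff_right:
  "sphere_inner f (\<lambda>x. g x - h x) = sphere_inner f g - sphere_inner f h"
  unfolding sphere_inner_def complex_cnj_diff right_diff_distrib
  by (intro sphere_int_diff continuous_intros c)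

end

lemma sphere_inner_cmult_left: "sphere_inner (\<lambda>x. a * f x) g = a * sphere_inner f g"
  by (simp add: sphere_inner_def sphere_int_cmult mult.assoc)

lemma sphere_inner_cmult_right: "sphere_inner f (\<lambda>x. a * g x) = cnj a * sphere_inner f g"
  by (simp add: sphere_inner_def mult.left_commute[of _ "cnj a"] sphere_int_cmult)

lemma hpoly_continuous: "hpoly d P \<Longrightarrow> continuous_on S P"
  by (rule continuous_on_subset[OF Ck_on_imp_continuous_on[OF hpoly_Ck_on]]) simp_all

lemma hpoly_Ck_on_punctured: "hpoly d P \<Longrightarrow> Ck_on k (-{0}) P"
  by (rule Ck_on_subset[OF hpoly_Ck_on]) simp_all

text \<open>Gram--Schmidt; the last conjunct records that \<open>h\<close> lies in the span of \<open>A\<close>.\<close>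

lemma sphere_projection_finite:
  assumes "finite A" "\<And>a. a \<in> A \<Longrightarrow> hpoly d a" "continuous_on (sphere 0 1) \<phi>"
  shows "\<exists>h. hpoly d h \<and> (\<forall>a\<in>A. sphere_inner (\<lambda>x. \<phi> x - h x) a = 0) \<and>
    (\<forall>f. continuous_on (sphere 0 1) f \<longrightarrow> (\<forall>a\<in>A. sphere_inner f a = 0) \<longrightarrow> sphere_inner f h = 0)"
  using assms
proof (induction A arbitrary: \<phi> rule: finite_induct)
  case empty
  have "sphere_inner f (\<lambda>x. 0) = 0" for f :: "real^'a \<Rightarrow> complex"
    by (simp add: sphere_inner_def)
  then show ?case
    by (intro exI[of _ "\<lambda>x. 0"]) (simp add: hpoly_zero)
next
  case (insert a A)
  have a: "hpoly d a" using insert.prems(1) by simp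
  have A: "\<And>b. b \<in> A \<Longrightarrow> hpoly d b" using insert.prems(1) by simp
  \<comment> \<open>The induction hypothesis is applied to \<open>a\<close> as well as to
    \<open>\<phi>\<close>: \<open>u\<close> is the projection of \<open>a\<close> to the earlier
    polynomials, so \<open>b = a - u\<close> is the new orthogonal direction.\<close>
  obtain u where u: "hpoly d u" "\<And>b. b \<in> A \<Longrightarrow> sphere_inner (\<lambda>x. a x - u x) b = 0"
    "\<And>f. continuous_on (sphere 0 1) f \<Longrightarrow> \<forall>b\<in>A. sphere_inner f b = 0 \<Longrightarrow> sphere_inner f u = 0"
    using insert.IH[OF A hpoly_continuous[OF a]] by auto
  obtain v where v: "hpoly d v" "\<And>b. b \<in> A \<Longrightarrow> sphere_inner (\<lambda>x. \<phi> x - v x) b = 0"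
    "\<And>f. continuous_on (sphere 0 1) f \<Longrightarrow> \<forall>b\<in>A. sphere_inner f b = 0 \<Longrightarrow> sphere_inner f v = 0"
    using insert.IH[OF A insert.prems(2)] by auto
  define b where "b x = a x - u x" for x
  have b: "hpoly d b" unfolding b_def by (rule hpoly_diff[OF a u(1)])
  \<comment> \<open>The Fourier coefficient along \<open>b\<close>. If the denominator is 0, then
    \<open>b\<close> vanishes on the sphere and orthogonality to it is automatic.\<close>
  define t where "t = sphere_inner (\<lambda>x. \<phi> x - v x) b / sphere_inner b b"
  define w where "w x = v x + t * b x" for x
  have w: "hpoly d w" unfolding w_def by (rule hpoly_add[OF v(1) hpoly_cmult[OF b]])
  note cont = hpoly_continuous[of d, where S = "sphere 0 1"]
  have cpv: "continuous_on (sphere 0 1) (\<lambda>x. \<phi> x - v x)"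
    by (intro continuous_on_diff insert.prems(2) cont[OF v(1)])
  have cpw: "continuous_on (sphere 0 1) (\<lambda>x. \<phi> x - w x)"
    by (intro continuous_on_diff insert.prems(2) cont[OF w])
  have pw: "sphere_inner (\<lambda>x. \<phi> x - w x) y
      = sphere_inner (\<lambda>x. \<phi> x - v x) y - t * sphere_inner b y" if "hpoly d y" for y
  proof -
    have "(\<lambda>x. \<phi> x - w x) = (\<lambda>x. (\<phi> x - v x) - t * b x)"
      by (simp add: w_def fun_eq_iff)
    then show ?thesis
      using sphere_inner_diff_left[OF cpv cont[OF hpoly_cmult[OF b, of t]] cont[OF that]]
      by (simp add: sphere_inner_cmult_left)
  qed
  have onA: "\<forall>y\<in>A. sphere_inner (\<lambda>x. \<phi> x - w x) y = 0"
    using pw[OF A] u(2) v(2) unfolding b_def[abs_def] by simp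
  have "sphere_inner (\<lambda>x. \<phi> x - w x) b = 0"
  proof (cases "sphere_inner b b = 0")
    case True
    then have b0: "b x = 0" if "norm x = 1" for x
      using sphere_int_norm_square_eq_0[OF cont[OF b] _ that] unfolding sphere_inner_def by blast
    show ?thesis
      unfolding sphere_inner_def by (subst sphere_int_cong[where g = "\<lambda>x. 0"]) (simp_all add: b0)
  next
    case False
    then show ?thesis unfolding pw[OF b] t_def by simp
  qed
  moreover have "sphere_inner (\<lambda>x. \<phi> x - w x) u = 0"
    by (rule u(3)[OF cpw onA])
  moreover have "sphere_inner f b = sphere_inner f a - sphere_inner f u"
    if "continuous_on (sphere 0 1) f" for f
    unfolding b_def[abs_def] by (rule sphere_inner_diff_right[OF that cont[OF a] cont[OF u(1)]])
  ultimately have "sphere_inner (\<lambda>x. \<phi> x - w x) a = 0"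
    and fb: "\<And>f. continuous_on (sphere 0 1) f \<Longrightarrow> sphere_inner f b = sphere_inner f a - sphere_inner f u"
    using cpw by simp_all
  moreover have "sphere_inner f w = 0"
    if f: "continuous_on (sphere 0 1) f" and z: "\<forall>y\<in>insert a A. sphere_inner f y = 0" for f
  proof -
    have "sphere_inner f w = sphere_inner f v + cnj t * sphere_inner f b"
      unfolding w_def[abs_def]
      using sphere_inner_add_right[OF f cont[OF v(1)] cont[OF hpoly_cmult[OF b, of t]]]
      by (simp add: sphere_inner_cmult_right)
    then show ?thesis
      using fb[OF f] u(3)[OF f] v(3)[OF f] z by simp
  qed
  ultimately show ?case
    using w onA by (intro exI[of _ w]) simp
qed

lemma sphere_projection:
  fixes \<phi> :: "real^'n \<Rightarrow> complex"
  assumes "continuous_on (sphere 0 1) \<phi>"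
  obtains h where "hpoly d h" "\<And>P. hpoly d P \<Longrightarrow> sphere_int (\<lambda>x. (\<phi> x - h x) * P x) = 0"
proof -
  let ?I = "{\<alpha>::'n \<Rightarrow> nat. (\<Sum>i\<in>UNIV. \<alpha> i) = d}"
  let ?m = "\<lambda>\<alpha> x. \<Prod>i\<in>UNIV. complex_of_real (x $ (i::'n)) ^ \<alpha> i"
  have m: "hpoly d (?m \<alpha>)" if "\<alpha> \<in> ?I" for \<alpha>
    using hpoly_monomial[of \<alpha>] that by simp
  have "finite (?m ` ?I)" "\<And>a. a \<in> ?m ` ?I \<Longrightarrow> hpoly d a"
    using m by (auto simp: finite_multi_indices)
  from sphere_projection_finite[OF this assms]
  obtain h where h: "hpoly d h" "\<And>\<alpha>. \<alpha> \<in> ?I \<Longrightarrow> sphere_inner (\<lambda>x. \<phi> x - h x) (?m \<alpha>) = 0"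
    by auto
  have c: "continuous_on (sphere 0 1) (\<lambda>x. \<phi> x - h x)"
    by (intro continuous_on_diff assms hpoly_continuous[OF h(1)])
  have "sphere_int (\<lambda>x. (\<phi> x - h x) * P x) = 0" if P: "hpoly d P" for P
  proof -
    obtain a where a: "P = (\<lambda>x. \<Sum>\<alpha>\<in>?I. a \<alpha> * ?m \<alpha> x)"
      using P unfolding homogeneous_polynomial_iff_hpoly[symmetric] homogeneous_polynomial_def ..
    \<comment> \<open>Monomials are real-valued, so \<open>cnj\<close> fixes them and the bilinear
      pairing becomes a combination of Hermitian ones.\<close>
    have "sphere_int (\<lambda>x. (\<phi> x - h x) * P x)
        = sphere_int (\<lambda>x. \<Sum>\<alpha>\<in>?I. a \<alpha> * ((\<phi> x - h x) * cnj (?m \<alpha> x)))"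
      by (simp add: a sum_distrib_left mult.left_commute)
    also have "\<dots> = (\<Sum>\<alpha>\<in>?I. a \<alpha> * sphere_inner (\<lambda>x. \<phi> x - h x) (?m \<alpha>))"
    proof -
      have "continuous_on (sphere 0 1) (\<lambda>x. a \<alpha> * ((\<phi> x - h x) * cnj (?m \<alpha> x)))" if "\<alpha> \<in> ?I" for \<alpha>
        by (intro continuous_on_mult continuous_on_const c hpoly_continuous[OF hpoly_cnj[OF m[OF that]]])
      from sphere_int_sum[OF this] show ?thesis
        by (simp only: sphere_int_cmult sphere_inner_def)
    qed
    also have "\<dots> = 0"
      using h(2) by simp
    finally show ?thesis .
  qed
  then show ?thesis using that h(1) by blast
qed

text \<open>Stone-Weierstrass yields polynomials of mixed degree, while moments are known for
  homogeneous ones; finite sums of these bridge the gap.\<close>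

inductive poly_sum :: "(real^'n::finite \<Rightarrow> complex) \<Rightarrow> bool" where
  poly_sum_hpoly: "hpoly d P \<Longrightarrow> poly_sum P"
| poly_sum_add: "poly_sum P \<Longrightarrow> poly_sum Q \<Longrightarrow> poly_sum (\<lambda>x. P x + Q x)"

lemma poly_sum_mult: "poly_sum P \<Longrightarrow> poly_sum Q \<Longrightarrow> poly_sum (\<lambda>x. P x * Q x)"
proof (induction rule: poly_sum.induct)
  case (poly_sum_hpoly d P)
  from poly_sum_hpoly(2,1) show ?case
  proof (induction rule: poly_sum.induct)
    case (poly_sum_hpoly e Q)
    then show ?case using hpoly_mult poly_sum.poly_sum_hpoly by blast
  next
    case (poly_sum_add Q R)
    then show ?case using poly_sum.poly_sum_add by (simp add: distrib_left)
  qed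
next
  case (poly_sum_add P R)
  then show ?case using poly_sum.poly_sum_add by (simp add: distrib_right)
qed

lemma real_polynomial_function_imp_poly_sum:
  fixes p :: "real^'n \<Rightarrow> real"
  shows "real_polynomial_function p \<Longrightarrow> poly_sum (\<lambda>x. complex_of_real (p x))"
proof (induction rule: real_polynomial_function.induct)
  case (linear p)
  have e: "p x = (\<Sum>i\<in>UNIV. p (axis i 1) * x $ i)" for x
  proof -
    have "p x = p (\<Sum>i\<in>UNIV. (x $ i) *\<^sub>R axis i 1)"
      using basis_expansion[of x] unfolding scalar_mult_eq_scaleR by simp
    then show ?thesis
      by (simp add: linear_sum[OF bounded_linear.linear[OF linear]]
          linear_cmul[OF bounded_linear.linear[OF linear]] mult.commute)
  qed
  have "(\<lambda>x. complex_of_real (p x)) = (\<lambda>x. \<Sum>i\<in>UNIV. of_real (p (axis i 1)) * of_real (x $ i))"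
    using arg_cong[OF e, of complex_of_real] unfolding of_real_sum of_real_mult by (intro ext)
  moreover have "hpoly 1 (\<lambda>x. \<Sum>i\<in>UNIV. complex_of_real (p (axis i 1)) * of_real (x $ i))"
    by (intro hpoly_sum hpoly_cmult hpoly_coord)
  ultimately show ?case
    using poly_sum_hpoly by metis
next
  case (const c)
  show ?case by (rule poly_sum_hpoly[OF hpoly_const])
next
  case (add f g)
  show ?case using poly_sum_add[OF add.IH] by simp
next
  case (mult f g)
  show ?case using poly_sum_mult[OF mult.IH] by simp
qed

text \<open>Completeness: approximate the conjugate of \<open>\<psi>\<close> uniformly by
  polynomials \<open>g\<close>. Since \<open>\<psi>\<close> times \<open>g\<close> integrates to 0,
  the square norm of \<open>\<psi>\<close> is arbitrarily small.\<close>

lemma eq_0_if_orthogonal_to_hpoly: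
  fixes \<psi> :: "real^'n \<Rightarrow> complex"
  assumes \<psi>: "continuous_on (sphere 0 1) \<psi>"
    and orth: "\<And>d P. hpoly d P \<Longrightarrow> sphere_int (\<lambda>x. \<psi> x * P x) = 0"
    and p: "norm p = 1"
  shows "\<psi> p = 0"
proof -
  have ps: "continuous_on (sphere 0 1) P \<and> sphere_int (\<lambda>x. \<psi> x * P x) = 0" if "poly_sum P" for P
    using that
  proof (induction rule: poly_sum.induct)
    case (poly_sum_hpoly d P)
    then show ?case using orth hpoly_continuous by blast
  next
    case (poly_sum_add P Q)
    then show ?case
      using sphere_int_add[of "\<lambda>x. \<psi> x * P x" "\<lambda>x. \<psi> x * Q x"]
      by (simp add: distrib_left continuous_on_add continuous_on_mult \<psi>)
  qed
  have pf: "continuous_on (sphere 0 1) g \<and> sphere_int (\<lambda>x. \<psi> x * g x) = 0"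
    if "polynomial_function g" for g :: "real^'n \<Rightarrow> complex"
  proof -
    have "real_polynomial_function (Re \<circ> g)" "real_polynomial_function (Im \<circ> g)"
      using that bounded_linear_Re bounded_linear_Im unfolding polynomial_function_def by simp_all
    then have R: "poly_sum (\<lambda>x. complex_of_real (Re (g x)))" "poly_sum (\<lambda>x. complex_of_real (Im (g x)))"
      using real_polynomial_function_imp_poly_sum[of "Re \<circ> g"]
        real_polynomial_function_imp_poly_sum[of "Im \<circ> g"] by simp_all
    have "poly_sum (\<lambda>x. complex_of_real (Re (g x)) + \<i> * complex_of_real (Im (g x)))"
      by (rule poly_sum_add[OF R(1) poly_sum_mult[OF poly_sum_hpoly[OF hpoly_const] R(2)]])
    then have "poly_sum g"
      using complex_eq by simp
    then show ?thesis by (rule ps)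
  qed
  define C where "C = (\<integral>x. shell_cutoff (x::real^'n) \<partial>lborel)"
  have C: "C \<ge> 0"
    unfolding C_def by (rule integral_nonneg_AE) (simp add: shell_cutoff_nonneg)
  have "bounded (\<psi> ` sphere 0 1)"
    by (intro compact_imp_bounded compact_continuous_image \<psi> compact_sphere)
  then obtain B where B: "B > 0" "\<And>x. norm x = 1 \<Longrightarrow> norm (\<psi> x) \<le> B"
    unfolding bounded_pos by auto
  have "norm (sphere_inner \<psi> \<psi>) \<le> e" if "e > 0" for e
  proof -
    \<comment> \<open>\<open>B\<close> bounds \<open>\<psi>\<close> and \<open>C\<close> is the
      total mass of the weight; \<open>C + 1\<close> keeps the denominator positive.\<close>
    define e' where "e' = e / (B * (C + 1))"
    have e': "e' > 0" using that B(1) C by (simp add: e'_def)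
    have cc: "continuous_on (sphere 0 1) (\<lambda>x. cnj (\<psi> x))"
      by (intro continuous_intros \<psi>)
    obtain g :: "real^'n \<Rightarrow> complex" where g: "polynomial_function g"
      "\<And>x. x \<in> sphere 0 1 \<Longrightarrow> norm (cnj (\<psi> x) - g x) < e'"
      using Stone_Weierstrass_polynomial_function[OF compact_sphere cc e'] by auto
    note gc = pf[OF g(1)]
    have c1: "continuous_on (sphere 0 1) (\<lambda>x. \<psi> x * cnj (\<psi> x))" "continuous_on (sphere 0 1) (\<lambda>x. \<psi> x * g x)"
      using gc by (auto intro!: continuous_on_mult \<psi> cc)
    have "sphere_inner \<psi> \<psi> = sphere_int (\<lambda>x. \<psi> x * cnj (\<psi> x) - \<psi> x * g x)"
      unfolding sphere_inner_def using sphere_int_diff[OF c1] gc by simp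
    also have "norm \<dots> \<le> (B * e') * C"
      unfolding C_def
    proof (rule sphere_int_norm_le)
      show "continuous_on (sphere 0 1) (\<lambda>x. \<psi> x * cnj (\<psi> x) - \<psi> x * g x)"
        by (intro continuous_on_diff c1)
      fix x :: "real^'n" assume x: "norm x = 1"
      have "norm (\<psi> x * (cnj (\<psi> x) - g x)) \<le> B * e'"
        unfolding norm_mult using B(2)[OF x] g(2)[of x] x B(1) by (intro mult_mono) auto
      then show "norm (\<psi> x * cnj (\<psi> x) - \<psi> x * g x) \<le> B * e'"
        by (simp add: right_diff_distrib)
    qed
    also have "\<dots> \<le> e"
    proof -
      have "(B * e') * C = e * (C / (C + 1))"
        using B(1) C by (simp add: e'_def)
      also have "\<dots> \<le> e * 1"
        using that C by (intro mult_left_mono) auto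
      finally show ?thesis by simp
    qed
    finally show ?thesis .
  qed
  then have "norm (sphere_inner \<psi> \<psi>) \<le> 0"
    using field_le_epsilon[of "norm (sphere_inner \<psi> \<psi>)" 0] by simp
  then have "sphere_int (\<lambda>x. \<psi> x * cnj (\<psi> x)) = 0"
    by (simp add: sphere_inner_def)
  from sphere_int_norm_square_eq_0[OF \<psi> this p] show ?thesis .
qed

text \<open>For \<open>CARD('n) = m + 1\<close> this is \<open>- k (k + m - 1)\<close>. The type
  argument supplies the dimension.\<close>

abbreviation sphere_eigenvalue :: "'n::finite itself \<Rightarrow> nat \<Rightarrow> complex" where
  "sphere_eigenvalue (n :: 'n itself) k \<equiv> - (of_nat k * (of_nat k + of_nat CARD('n) - 2))"

lemma hpoly_norm_square: "hpoly 2 (\<lambda>x. complex_of_real ((norm x)\<^sup>2))"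
proof -
  have "hpoly (1 + 1) (\<lambda>x. \<Sum>i\<in>UNIV. complex_of_real (x $ i) * of_real (x $ i))"
    by (intro hpoly_sum hpoly_mult hpoly_coord)
  then show ?thesis
    unfolding sum_coord_square one_add_one .
qed

section \<open>Moments of an eigenfunction against homogeneous polynomials\<close>

context
  fixes \<phi> :: "real^'n::finite \<Rightarrow> complex" and l :: complex
  assumes \<phi>: "Ck_on (Suc (Suc 0)) (-{0}) \<phi>"
    and eig: "\<And>x. norm x = 1 \<Longrightarrow> sphere_laplacian \<phi> x = l * \<phi> x"
begin

lemma eigenfunction_moment:
  assumes P: "hpoly k P"
  shows "(l - sphere_eigenvalue TYPE('n) k) * sphere_int (\<lambda>x. \<phi> x * P x)
    = sphere_int (\<lambda>x. \<phi> x * laplacian P x)"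
proof -
  let ?e = "sphere_eigenvalue TYPE('n) k"
  have c: "continuous_on (sphere 0 1) \<phi>" by (rule Ck_on_imp_continuous_sphere[OF \<phi>])
  have "l * sphere_int (\<lambda>x. \<phi> x * P x) = sphere_int (\<lambda>x. sphere_laplacian \<phi> x * P x)"
    unfolding sphere_int_cmult[symmetric] by (rule sphere_int_cong) (simp add: eig)
  also have "\<dots> = sphere_int (\<lambda>x. \<phi> x * sphere_laplacian P x)"
    by (rule sphere_int_laplacian_symmetric[OF \<phi> hpoly_Ck_on_punctured[OF P]])
  also have "\<dots> = sphere_int (\<lambda>x. \<phi> x * laplacian P x + ?e * (\<phi> x * P x))"
    by (rule sphere_int_cong) (simp add: hpoly_sphere_laplacian[OF P] algebra_simps)
  also have "\<dots> = sphere_int (\<lambda>x. \<phi> x * laplacian P x) + sphere_int (\<lambda>x. ?e * (\<phi> x * P x))"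
    by (intro sphere_int_add continuous_on_mult continuous_on_const c hpoly_continuous[OF P]
        hpoly_continuous[OF hpoly_laplacian[OF P]])
  finally show ?thesis
    unfolding sphere_int_cmult by (simp only: left_diff_distrib) (simp only: algebra_simps)
qed

text \<open>Off resonance the moment identity reduces degree \<open>k\<close> to
  \<open>k - 2\<close>, so only resonant degrees up to \<open>k\<close> need to be checked. The
  premise holds vacuously when there are none; for the residual of a projection it holds by
  orthogonality.\<close>

lemma eigenfunction_moments_vanish:
  assumes "\<And>j P. j \<le> k \<Longrightarrow> l = sphere_eigenvalue TYPE('n) j \<Longrightarrow> hpoly j P
      \<Longrightarrow> sphere_int (\<lambda>x. \<phi> x * P x) = 0"
    and "hpoly k P"
  shows "sphere_int (\<lambda>x. \<phi> x * P x) = 0"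
  using assms
proof (induction k arbitrary: P rule: less_induct)
  case (less k)
  show ?case
  proof (cases "l = sphere_eigenvalue TYPE('n) k")
    case True
    then show ?thesis by (rule less.prems(1)[OF order_refl _ less.prems(2)])
  next
    case False
    have "sphere_int (\<lambda>x. \<phi> x * laplacian P x) = 0"
    proof (cases "k < 2")
      case True
      then show ?thesis by (simp add: hpoly_laplacian_less_2[OF less.prems(2)])
    next
      case k: False
      show ?thesis
      proof (rule less.IH[OF _ less.prems(1) hpoly_laplacian[OF less.prems(2)]])
        show "k - 2 < k" using k by simp
      qed simp_all
    qed
    then have "(l - sphere_eigenvalue TYPE('n) k) * sphere_int (\<lambda>x. \<phi> x * P x) = 0"
      unfolding eigenfunction_moment[OF less.prems(2)] .
    then show ?thesis
      using False unfolding mult_eq_0_iff by (simp only: right_minus_eq simp_thms)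
  qed
qed

lemma eigenvalue_of_eigenfunction:
  assumes "norm p = 1" "\<phi> p \<noteq> 0"
  shows "\<exists>k. l = sphere_eigenvalue TYPE('n) k"
proof (rule ccontr)
  assume "\<not> ?thesis"
  then have "sphere_int (\<lambda>x. \<phi> x * P x) = 0" if "hpoly k P" for k P
    by (intro eigenfunction_moments_vanish[OF _ that]) blast
  from eq_0_if_orthogonal_to_hpoly[OF Ck_on_imp_continuous_sphere[OF \<phi>] this assms(1)]
  show False using assms(2) by simp
qed

text \<open>A polynomial can be tested against its own conjugate, of the same degree
  \<open>D\<close>, so the descent meets only degrees up to \<open>D\<close>. Density of polynomials
  would give no such bound.\<close>

lemma eigenvalue_of_polynomial_eigenfunction:
  assumes "hpoly D \<phi>" "norm p = 1" "\<phi> p \<noteq> 0"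
  shows "\<exists>k\<le>D. l = sphere_eigenvalue TYPE('n) k"
proof (rule ccontr)
  assume "\<not> ?thesis"
  then have "sphere_int (\<lambda>x. \<phi> x * cnj (\<phi> x)) = 0"
    by (intro eigenfunction_moments_vanish[OF _ hpoly_cnj[OF assms(1)]]) blast
  from sphere_int_norm_square_eq_0[OF hpoly_continuous[OF assms(1)] this assms(2)]
  show False using assms(3) by simp
qed

end

lemma sphere_laplacian_diff:
  assumes f: "Ck_on (Suc (Suc 0)) (-{0}) f" and g: "Ck_on (Suc (Suc 0)) (-{0}) g" and x: "x \<in> -{0}"
  shows "sphere_laplacian (\<lambda>x. f x - g x) x = sphere_laplacian f x - sphere_laplacian g x"
proof -
  have 1: "pd i (\<lambda>x. f x - g x) y = pd i f y - pd i g y" if "y \<in> -{0}" for i y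
    by (rule pd_diff[OF Ck_on_differentiable[OF f that] Ck_on_differentiable[OF g that]])
  have 2: "pd j (pd i (\<lambda>x. f x - g x)) x = pd j (pd i f) x - pd j (pd i g) x" for i j
  proof -
    have "pd j (pd i (\<lambda>x. f x - g x)) x = pd j (\<lambda>x. pd i f x - pd i g x) x"
      by (rule pd_cong[OF Ck_on_differentiable[OF Ck_on_pd[OF Ck_on_diff[OF open_punctured f g]] x]
            open_punctured x 1])
    then show ?thesis
      using pd_diff[OF Ck_on_differentiable[OF Ck_on_pd[OF f] x] Ck_on_differentiable[OF Ck_on_pd[OF g] x]]
      by simp
  qed
  show ?thesis
    by (simp add: sphere_laplacian_def laplacian_def radial_deriv2_def radial_deriv_def 1[OF x] 2
        sum_subtractf algebra_simps)
qed

text \<open>\<open>k (k + n - 2)\<close> is strictly increasing in \<open>k\<close> for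
  \<open>n \<ge> 2\<close>. For \<open>n = 1\<close> the degrees 0 and 1 would share an
  eigenvalue.\<close>

lemma sphere_eigenvalue_inj:
  assumes "sphere_eigenvalue TYPE('n::finite) j = sphere_eigenvalue TYPE('n) k" "CARD('n) \<ge> 2"
  shows "j = k"
proof -
  have "complex_of_nat j * (of_nat j + of_nat (CARD('n) - 2)) = of_nat k * (of_nat k + of_nat (CARD('n) - 2))"
    using assms by (simp add: of_nat_diff algebra_simps)
  then have "complex_of_nat (j * (j + (CARD('n) - 2))) = of_nat (k * (k + (CARD('n) - 2)))"
    by simp
  then have e: "j * (j + (CARD('n) - 2)) = k * (k + (CARD('n) - 2))"
    by (simp only: of_nat_eq_iff)
  show ?thesis
  proof (rule ccontr)
    assume "j \<noteq> k"
    then consider "j < k" | "k < j" by linarith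
    then show False
    proof cases
      case 1
      then show False
        using e mult_strict_mono[of j k "j + (CARD('n) - 2)" "k + (CARD('n) - 2)"] by simp
    next
      case 2
      then show False
        using e mult_strict_mono[of k j "k + (CARD('n) - 2)" "j + (CARD('n) - 2)"] by simp
    qed
  qed
qed

text \<open>The projection \<open>h\<close> of \<open>\<phi>\<close> to the polynomials of degree \<open>d\<close> is automatically harmonic: the
  Laplacian of \<open>h\<close> restricted to the sphere agrees with a polynomial of degree \<open>d\<close> and is orthogonal
  to all of them.\<close>

lemma eigenfunction_eq_harmonic:
  fixes \<phi> :: "real^'n \<Rightarrow> complex"
  assumes \<phi>: "Ck_on (Suc (Suc 0)) (-{0}) \<phi>"
    and eig: "\<And>x. norm x = 1 \<Longrightarrow> sphere_laplacian \<phi> x = sphere_eigenvalue TYPE('n) d * \<phi> x"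
    and n: "CARD('n) \<ge> 2"
  obtains h where "hpoly d h" "\<And>x. laplacian h x = 0" "\<And>x. norm x = 1 \<Longrightarrow> \<phi> x = h x"
proof -
  let ?e = "sphere_eigenvalue TYPE('n) d"
  have c: "continuous_on (sphere 0 1) \<phi>" by (rule Ck_on_imp_continuous_sphere[OF \<phi>])
  obtain h where h: "hpoly d h" "\<And>P. hpoly d P \<Longrightarrow> sphere_int (\<lambda>x. (\<phi> x - h x) * P x) = 0"
    using sphere_projection[OF c] by blast
  note hc = hpoly_continuous[OF h(1), of "sphere 0 1"]
  have H: "laplacian h x = 0" for x
  proof (cases "d < 2")
    case True
    then show ?thesis by (rule hpoly_laplacian_less_2[OF h(1)])
  next
    case False
    \<comment> \<open>The factor \<open>(norm x)\<^sup>2\<close>, equal to 1 on the sphere, brings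
      the Laplacian back to degree \<open>d\<close>, so that it can serve as a test polynomial for
      \<open>h(2)\<close>.\<close>
    have rho: "hpoly d (\<lambda>x. of_real ((norm x)\<^sup>2) * laplacian P x)" if "hpoly d P" for P :: "real^'n \<Rightarrow> complex"
    proof -
      have "2 + (d - 2) = d" using False by simp
      with hpoly_mult[OF hpoly_norm_square hpoly_laplacian[OF that]] show ?thesis
        by (simp only:)
    qed
    have "sphere_int (\<lambda>x. laplacian h x * P x) = 0" if P: "hpoly d P" for P
    proof -
      note LPc = hpoly_continuous[OF hpoly_laplacian[OF P], of "sphere 0 1"]
      have "sphere_int (\<lambda>x. laplacian h x * P x) = sphere_int (\<lambda>x. sphere_laplacian h x * P x - ?e * (h x * P x))"
        by (rule sphere_int_cong) (simp add: hpoly_sphere_laplacian[OF h(1)] algebra_simps)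
      also have "\<dots> = sphere_int (\<lambda>x. sphere_laplacian h x * P x) - sphere_int (\<lambda>x. ?e * (h x * P x))"
      proof (rule sphere_int_diff)
        have "continuous_on (sphere 0 1) (\<lambda>x. (laplacian h x + ?e * h x) * P x)"
          by (intro continuous_on_mult continuous_on_add continuous_on_const hc hpoly_continuous[OF P]
              hpoly_continuous[OF hpoly_laplacian[OF h(1)]])
        then show "continuous_on (sphere 0 1) (\<lambda>x. sphere_laplacian h x * P x)"
          by (rule continuous_on_eq) (simp add: hpoly_sphere_laplacian[OF h(1)])
        show "continuous_on (sphere 0 1) (\<lambda>x. ?e * (h x * P x))"
          by (intro continuous_on_mult continuous_on_const hc hpoly_continuous[OF P])
      qed
      also have "sphere_int (\<lambda>x. sphere_laplacian h x * P x) = sphere_int (\<lambda>x. h x * sphere_laplacian P x)"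
        by (rule sphere_int_laplacian_symmetric[OF hpoly_Ck_on_punctured[OF h(1)] hpoly_Ck_on_punctured[OF P]])
      also have "\<dots> = sphere_int (\<lambda>x. h x * laplacian P x + ?e * (h x * P x))"
        by (rule sphere_int_cong) (simp add: hpoly_sphere_laplacian[OF P] algebra_simps)
      also have "\<dots> = sphere_int (\<lambda>x. h x * laplacian P x) + sphere_int (\<lambda>x. ?e * (h x * P x))"
        by (intro sphere_int_add continuous_on_mult continuous_on_const hc hpoly_continuous[OF P] LPc)
      \<comment> \<open>The eigenvalue terms cancel because \<open>h\<close> and \<open>P\<close>
        have the same degree.\<close>
      finally have "sphere_int (\<lambda>x. laplacian h x * P x) = sphere_int (\<lambda>x. h x * laplacian P x)"
        by simp
      also have "\<dots> = sphere_int (\<lambda>x. \<phi> x * laplacian P x) - sphere_int (\<lambda>x. (\<phi> x - h x) * laplacian P x)"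
        using sphere_int_diff[OF continuous_on_mult[OF c LPc] continuous_on_mult[OF hc LPc]]
        by (simp add: left_diff_distrib)
      also have "sphere_int (\<lambda>x. (\<phi> x - h x) * laplacian P x)
          = sphere_int (\<lambda>x. (\<phi> x - h x) * (of_real ((norm x)\<^sup>2) * laplacian P x))"
        by (rule sphere_int_cong) simp
      also have "\<dots> = 0" by (rule h(2)[OF rho[OF P]])
      \<comment> \<open>This is the moment identity at resonance, where its left side is 0.\<close>
      also have "sphere_int (\<lambda>x. \<phi> x * laplacian P x) = 0"
        using eigenfunction_moment[OF \<phi> eig P] by simp
      finally show ?thesis by simp
    qed
    from this[OF hpoly_cnj[OF rho[OF h(1)]]]
    have "sphere_int (\<lambda>x. laplacian h x * cnj (of_real ((norm x)\<^sup>2) * laplacian h x)) = 0" .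
    moreover have "sphere_int (\<lambda>x. laplacian h x * cnj (of_real ((norm x)\<^sup>2) * laplacian h x))
        = sphere_int (\<lambda>x. laplacian h x * cnj (laplacian h x))"
      by (rule sphere_int_cong) simp
    ultimately have "laplacian h x = 0" if "norm x = 1" for x
      using sphere_int_norm_square_eq_0[OF hpoly_continuous[OF hpoly_laplacian[OF h(1)]] _ that] by simp
    then have "laplacian h = (\<lambda>x. 0)"
      by (intro hpoly_eq_on_sphere[OF hpoly_laplacian[OF h(1)] hpoly_zero]) simp
    then show ?thesis by simp
  qed
  let ?\<psi> = "\<lambda>x. \<phi> x - h x"
  have \<psi>: "Ck_on (Suc (Suc 0)) (-{0}) ?\<psi>"
    by (rule Ck_on_diff[OF open_punctured \<phi> hpoly_Ck_on_punctured[OF h(1)]])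
  have eig\<psi>: "sphere_laplacian ?\<psi> x = ?e * ?\<psi> x" if "norm x = 1" for x
  proof -
    have "x \<in> -{0}" using that by auto
    from sphere_laplacian_diff[OF \<phi> hpoly_Ck_on_punctured[OF h(1)] this]
    show ?thesis
      unfolding eig[OF that] hpoly_sphere_laplacian[OF h(1)] H by (simp add: algebra_simps)
  qed
  have "sphere_int (\<lambda>x. ?\<psi> x * P x) = 0" if "hpoly k P" for k P
  \<comment> \<open>By injectivity of the eigenvalue the only resonant degree is \<open>d\<close>,
    where the residual is orthogonal by the choice of \<open>h\<close>.\<close>
  proof (rule eigenfunction_moments_vanish[OF \<psi> eig\<psi> _ that])
    fix j and Q :: "real^'n \<Rightarrow> complex"
    assume "?e = sphere_eigenvalue TYPE('n) j" "hpoly j Q"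
    then show "sphere_int (\<lambda>x. ?\<psi> x * Q x) = 0"
      using sphere_eigenvalue_inj[OF _ n] h(2) by metis
  qed
  from eq_0_if_orthogonal_to_hpoly[OF Ck_on_imp_continuous_sphere[OF \<psi>] this]
  have "\<phi> x = h x" if "norm x = 1" for x using that by simp
  then show ?thesis using that h(1) H by blast
qed

section \<open>Squares of integers on a quadratic progression\<close>

text \<open>Integers within 1/2 of the same limit differ by less than 1.\<close>

lemma int_seq_convergent_eventually_const:
  fixes g :: "nat \<Rightarrow> int"
  assumes "(\<lambda>k. real_of_int (g k)) \<longlonglongrightarrow> L"
  obtains K t where "\<And>k. k \<ge> K \<Longrightarrow> g k = t" "L = real_of_int t"
proof -
  obtain K where K: "\<And>k. k \<ge> K \<Longrightarrow> \<bar>real_of_int (g k) - L\<bar> < 1/2"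
    using LIMSEQ_D[OF assms, of "1/2"] by auto
  have c: "g k = g K" if "k \<ge> K" for k
    using K[OF that] K[of K] by linarith
  have "(\<lambda>k. real_of_int (g k)) \<longlonglongrightarrow> real_of_int (g K)"
    by (intro tendsto_eventually eventually_sequentiallyI[of K] arg_cong[where f = real_of_int] c)
  then have "L = real_of_int (g K)"
    by (rule LIMSEQ_unique[OF assms])
  with c show ?thesis by (rule that)
qed

text \<open>The numbers \<open>(2 e + N)\<^sup>2\<close> form a quadratic progression, so \<open>2 e + N\<close> is eventually linear in \<open>k\<close>.\<close>

lemma eigenvalue_progression:
  fixes s :: real and d N :: nat
  assumes e: "\<And>k. k \<ge> 1 \<Longrightarrow> e k \<le> k * d \<and>
      real (e k) * (real (e k) + real N) = real k * real d * (real d + real N) + real k * (real k - 1) * s"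
  shows "s = (real d)\<^sup>2"
proof -
  define D where "D = real d * (real d + real N)"
  \<comment> \<open>Completing the square: \<open>4 e (e + N) + N^2 = (2 e + N)^2\<close>.\<close>
  define A where "A k = 2 * int (e k) + int N" for k
  let ?q = "\<lambda>k::nat. 4 * s * (real k)\<^sup>2 + 4 * (D - s) * real k + (real N)\<^sup>2"
  have A2: "(real_of_int (A k))\<^sup>2 = ?q k" if "k \<ge> 1" for k
  proof -
    have "(real_of_int (A k))\<^sup>2 = 4 * (real (e k) * (real (e k) + real N)) + (real N)\<^sup>2"
      by (simp add: A_def power2_eq_square algebra_simps)
    then show ?thesis
      using e[OF that] by (simp add: D_def power2_eq_square algebra_simps)
  qed
  have A: "real_of_int (A k) = sqrt (?q k)" if "k \<ge> 1" for k
    using real_sqrt_unique[OF A2[OF that]] by (simp add: A_def)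
  have D: "D \<ge> 0" by (simp add: D_def)
  \<comment> \<open>Common to the linear and the square-root growth of \<open>A\<close>: its
    increments converge and are integers, hence are eventually equal to
    \<open>2 * sqrt s\<close>.\<close>
  have limit: "s = (real d)\<^sup>2"
    if lim: "(\<lambda>k. sqrt (?q (Suc k)) - sqrt (?q k)) \<longlonglongrightarrow> 2 * sqrt s" and s: "s \<ge> 0" "s = 0 \<longrightarrow> D > 0"
  proof -
    have "(\<lambda>k. real_of_int (A (Suc k) - A k)) \<longlonglongrightarrow> 2 * sqrt s"
    proof (rule Lim_transform_eventually[OF lim])
      show "\<forall>\<^sub>F k in sequentially. sqrt (?q (Suc k)) - sqrt (?q k) = real_of_int (A (Suc k) - A k)"
        using A by (intro eventually_sequentiallyI[of 1]) simp
    qed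
    then obtain K t where K: "\<And>k. k \<ge> K \<Longrightarrow> A (Suc k) - A k = t" "2 * sqrt s = real_of_int t"
      by (rule int_seq_convergent_eventually_const) blast
    define k where "k = Suc K"
    define \<sigma> where "\<sigma> = sqrt s"
    \<comment> \<open>Intercept of the line with slope \<open>2 * \<sigma>\<close> through two
      consecutive values of \<open>A\<close>. Comparing its square with \<open>?q\<close> at these
      two points already gives both lower coefficients.\<close>
    define b where "b = real_of_int (A k) - 2 * \<sigma> * real k"
    have ss: "s = \<sigma>\<^sup>2" "\<sigma> \<ge> 0" using s(1) by (simp_all add: \<sigma>_def)
    have k: "k \<ge> 1" by (simp add: k_def)
    have "A (Suc k) - A k = t" by (rule K(1)) (simp add: k_def)
    then have A': "real_of_int (A (Suc k)) = real_of_int (A k) + 2 * \<sigma>"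
      using K(2) by (simp add: \<sigma>_def)
    have e1: "(2 * \<sigma> * real k + b)\<^sup>2 = ?q k"
      using A2[OF k] by (simp add: b_def)
    have e2: "(2 * \<sigma> * (real k + 1) + b)\<^sup>2 = 4 * s * (real k + 1)\<^sup>2 + 4 * (D - s) * (real k + 1) + (real N)\<^sup>2"
      using A2[of "Suc k"] unfolding A' b_def by (simp add: algebra_simps)
    have sb: "\<sigma> * b = D - \<sigma>\<^sup>2"
      using e1 e2 unfolding ss(1) by (simp add: power2_eq_square algebra_simps)
    have "b\<^sup>2 = (2 * \<sigma> * real k + b)\<^sup>2 - 4 * \<sigma>\<^sup>2 * (real k)\<^sup>2 - 4 * (\<sigma> * b) * real k"
      by (simp add: power2_eq_square algebra_simps)
    also have "\<dots> = (real N)\<^sup>2"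
      unfolding e1 sb ss(1) by (simp add: power2_eq_square algebra_simps)
    finally have b: "b = real N \<or> b = - real N"
      by (simp add: power2_eq_iff)
    have \<sigma>: "\<sigma> > 0"
      using sb ss s(2) by (cases "\<sigma> = 0") auto
    have "\<sigma> = real d"
    proof -
      have c1: "\<sigma> = real d" if "b = real N"
      proof -
        have "(\<sigma> - real d) * (\<sigma> + real d + real N) = 0"
          using sb that by (simp add: D_def power2_eq_square algebra_simps)
        moreover have "\<sigma> + real d + real N > 0" using \<sigma> by simp
        ultimately show ?thesis by simp
      qed
      show ?thesis
      proof (cases "b = real N")
        case False
        then have bN: "b = - real N" using b by simp
        have "(\<sigma> + real d) * (\<sigma> - real d - real N) = 0"
          using sb bN by (simp add: D_def power2_eq_square algebra_simps)
        moreover have "\<sigma> + real d > 0" using \<sigma> by simp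
        \<comment> \<open>The second slope: here \<open>e (Suc k)\<close> equals
          \<open>(k + 1) (d + N) - N\<close>, which exceeds \<open>(k + 1) d\<close> unless
          \<open>N = 0\<close>.\<close>
        ultimately have \<sigma>d: "\<sigma> = real d + real N" by simp
        have "2 * real (e (Suc k)) + real N = 2 * \<sigma> * (real k + 1) - real N"
          using A' bN by (simp add: b_def A_def algebra_simps)
        moreover have "real (e (Suc k)) \<le> (real k + 1) * real d"
          using e[of "Suc k"] by (metis le_add1 of_nat_Suc of_nat_le_iff of_nat_mult plus_1_eq_Suc add.commute)
        ultimately have "real N * real k \<le> 0"
          unfolding \<sigma>d by (simp add: algebra_simps)
        then have "N = 0" using k by (simp add: mult_le_0_iff)
        then show ?thesis using \<sigma>d by simp
      qed (rule c1)
    qed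
    then show ?thesis using ss by simp
  qed
  \<comment> \<open>For \<open>s < 0\<close> the square \<open>?q k\<close> would become negative;
    \<open>s = D = 0\<close> forces \<open>d = 0\<close>. In the last two cases
    \<open>sqrt (?q k)\<close> grows like the square root of \<open>k\<close> or linearly.\<close>
  consider "s < 0" | "s = 0" "D = 0" | "s = 0" "D > 0" | "s > 0" using D by linarith
  then show ?thesis
  proof cases
    case 1
    then have "filterlim ?q at_bot at_top" by real_asymp
    then have "\<forall>\<^sub>F k in sequentially. ?q k \<le> -1"
      unfolding filterlim_at_bot by blast
    then obtain k where "k \<ge> 1" "?q k \<le> -1"
      unfolding eventually_sequentially by (metis nat_le_linear)
    then show ?thesis using A2[of k] zero_le_power2[of "real_of_int (A k)"] by linarith
  next
    case 2
    then show ?thesis by (auto simp: D_def)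
  next
    case 3
    have "(\<lambda>k. sqrt (4 * D * real (Suc k) + (real N)\<^sup>2) - sqrt (4 * D * real k + (real N)\<^sup>2)) \<longlonglongrightarrow> 0"
      using 3(2) by real_asymp
    then show ?thesis
      using 3 by (intro limit) simp_all
  next
    case 4
    have "(\<lambda>k. sqrt (?q (Suc k)) - sqrt (?q k)) \<longlonglongrightarrow> 2 * sqrt s"
      using 4 by (real_asymp, simp add: powr_half_sqrt real_sqrt_mult field_simps)
    then show ?thesis
      using 4 by (intro limit) simp_all
  qed
qed

section \<open>Eigenfamilies\<close>

lemma smooth_map_on_hpoly:
  assumes "hpoly d P" "\<And>x. x \<in> M \<Longrightarrow> f x = P x"
  shows "smooth_map_on M f"
  unfolding smooth_map_on_def
  using hpoly_Ck_on[OF assms(1)] assms(2) by (intro ballI exI[of _ UNIV] exI[of _ P]) simp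

text \<open>The first summand of the eigenvalue is the contribution of
  \<open>laplacian_power\<close>, the second that of the Euler terms in degree
  \<open>Suc k * d\<close>.\<close>

lemma harmonic_power_eigenfunction:
  fixes P :: "real^'n \<Rightarrow> complex"
  assumes P: "hpoly d P" "\<And>x. laplacian P x = 0"
    and grad: "\<And>x. norm x = 1 \<Longrightarrow> grad_prod P P x = c * (P x)\<^sup>2" and x: "norm x = 1"
  shows "sphere_laplacian (\<lambda>x. P x ^ Suc k) x
    = (of_nat (Suc k * k) * c + sphere_eigenvalue TYPE('n) (Suc k * d)) * P x ^ Suc k"
proof -
  have "of_nat (Suc k * k) * P x ^ (k - 1) * grad_prod P P x = of_nat (Suc k * k) * c * P x ^ Suc k"
    unfolding grad[OF x] by (cases k) (simp_all add: power2_eq_square mult_ac)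
  then show ?thesis
    unfolding hpoly_sphere_laplacian[OF hpoly_power[OF P(1)]] laplacian_power[OF P] x
    by (simp add: algebra_simps del: of_nat_Suc of_nat_mult power_Suc mult_Suc)
qed

lemma harmonic_eigenfunction_mu:
  fixes P :: "real^'n \<Rightarrow> complex"
  assumes P: "hpoly d P" "\<And>x. laplacian P x = 0"
    and grad: "\<And>x. norm x = 1 \<Longrightarrow> grad_prod P P x = (\<mu> + (of_nat d)\<^sup>2) * (P x)\<^sup>2"
    and p: "norm p = 1" "P p \<noteq> 0" and n: "CARD('n) \<ge> 2"
  shows "\<mu> = - (of_nat d)\<^sup>2"
proof -
  define N where "N = CARD('n) - 2"
  have N: "complex_of_nat CARD('n) = of_nat N + 2"
    using n by (simp add: N_def of_nat_diff)
  have "\<exists>e\<le>k * d. complex_of_nat e * (of_nat e + of_nat N)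
      = of_nat k * of_nat d * (of_nat d + of_nat N) - of_nat k * (of_nat k - 1) * \<mu>" if "k \<ge> 1" for k
  proof -
    obtain j where j: "k = Suc j" using \<open>k \<ge> 1\<close> by (cases k) auto
    have "\<exists>e\<le>k * d. of_nat (k * j) * (\<mu> + (of_nat d)\<^sup>2) + sphere_eigenvalue TYPE('n) (k * d)
        = sphere_eigenvalue TYPE('n) e"
    proof (rule eigenvalue_of_polynomial_eigenfunction[where \<phi> = "\<lambda>x. P x ^ k" and p = p])
      show "hpoly (k * d) (\<lambda>x. P x ^ k)" by (rule hpoly_power[OF P(1)])
      then show "Ck_on (Suc (Suc 0)) (-{0}) (\<lambda>x. P x ^ k)" by (rule hpoly_Ck_on_punctured)
      show "sphere_laplacian (\<lambda>x. P x ^ k) x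
          = (of_nat (k * j) * (\<mu> + (of_nat d)\<^sup>2) + sphere_eigenvalue TYPE('n) (k * d)) * P x ^ k"
        if "norm x = 1" for x
        unfolding j by (rule harmonic_power_eigenfunction[OF P grad that])
    qed (use p in simp_all)
    then obtain e where e: "e \<le> k * d"
      "of_nat (k * j) * (\<mu> + (of_nat d)\<^sup>2) + sphere_eigenvalue TYPE('n) (k * d) = sphere_eigenvalue TYPE('n) e"
      by blast
    have "complex_of_nat e * (of_nat e + of_nat N)
        = of_nat k * of_nat d * (of_nat k * of_nat d + of_nat N) - of_nat (k * j) * (\<mu> + (of_nat d)\<^sup>2)"
      using e(2) unfolding N by (simp add: algebra_simps)
    also have "\<dots> = of_nat k * of_nat d * (of_nat d + of_nat N) - of_nat k * (of_nat k - 1) * \<mu>"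
      unfolding j by (simp add: algebra_simps power2_eq_square)
    finally show ?thesis using e(1) by blast
  qed
  then obtain e where e: "\<And>k. k \<ge> 1 \<Longrightarrow> e k \<le> k * d \<and> complex_of_nat (e k) * (of_nat (e k) + of_nat N)
      = of_nat k * of_nat d * (of_nat d + of_nat N) - of_nat k * (of_nat k - 1) * \<mu>"
    by metis
  have re: "real (e k) * (real (e k) + real N)
      = real k * real d * (real d + real N) - real k * (real k - 1) * Re \<mu>" 
    and im: "real k * (real k - 1) * Im \<mu> = 0" if "k \<ge> 1" for k
    using arg_cong[OF conjunct2[OF e[OF that]], of Re] arg_cong[OF conjunct2[OF e[OF that]], of Im]
    by simp_all
  \<comment> \<open>At \<open>k = 2\<close> the factor \<open>k (k - 1)\<close> is nonzero. The real
    part is then the progression with \<open>s = - Re \<mu>\<close>.\<close>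
  have "Im \<mu> = 0" using im[of 2] by simp
  moreover have "- Re \<mu> = (real d)\<^sup>2"
    by (rule eigenvalue_progression[of e d N]) (use e re in \<open>auto simp: algebra_simps\<close>)
  ultimately show ?thesis
    by (simp add: complex_eq_iff power2_eq_square)
qed

text \<open>Maps on the sphere are represented by extensional functions, so that equality in
  \<open>F\<close> is equality on the sphere. The last assumption concerns families that are empty
  or consist of the zero map only.\<close>

theorem theorem1:
  fixes m :: nat
    and F :: "(real^'n \<Rightarrow> complex) set"
    and l \<mu> :: complex
  assumes "m \<ge> 1"
    and "CARD('n) = m + 1"
    and "F \<subseteq> extensional (sphere 0 1)"
    and "(\<forall>\<phi>\<in>F. \<forall>x\<in>sphere 0 1. \<phi> x = 0) \<longrightarrow>
      (\<exists>d::nat. l = - (of_nat d * (of_nat d + of_nat m - 1)) \<and> \<mu> = - (of_nat d)\<^sup>2)"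
  shows "eigenfamily (sphere 0 1) l \<mu> F \<longleftrightarrow>
    (\<exists>d Ft. eigenfamily (UNIV :: (real^'n) set) 0 0 Ft \<and>
       (\<forall>P\<in>Ft. homogeneous_polynomial d P) \<and>
       bij_betw (\<lambda>P. restrict P (sphere 0 1)) Ft F \<and>
       l = - (of_nat d * (of_nat d + of_nat m - 1)) \<and>
       \<mu> = - (of_nat d)\<^sup>2)"
proof
  have n: "CARD('n) \<ge> 2" using assms(1,2) by simp
  have ev: "sphere_eigenvalue TYPE('n) d = - (of_nat d * (of_nat d + of_nat m - 1))" for d
    using assms(2) by (simp add: algebra_simps)
  let ?S = "sphere (0::real^'n) 1"
  show "\<exists>d Ft. eigenfamily (UNIV :: (real^'n) set) 0 0 Ft \<and>
       (\<forall>P\<in>Ft. homogeneous_polynomial d P) \<and>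
       bij_betw (\<lambda>P. restrict P ?S) Ft F \<and>
       l = - (of_nat d * (of_nat d + of_nat m - 1)) \<and> \<mu> = - (of_nat d)\<^sup>2"
    if F: "eigenfamily ?S l \<mu> F"
  proof -
    have C: "Ck_on k (-{0}) (\<lambda>x. \<phi> (sgn x))" if "\<phi> \<in> F" for \<phi> k
      using F that unfolding eigenfamily_def by (intro smooth_map_on_sphere_extension) blast
    have s: "\<phi> (sgn x) = \<phi> x" if "norm x = 1" for x and \<phi> :: "real^'n \<Rightarrow> complex"
      using that by (simp add: sgn_div_norm)
    have eig: "sphere_laplacian (\<lambda>x. \<phi> (sgn x)) x = l * \<phi> (sgn x)" if "\<phi> \<in> F" "norm x = 1" for \<phi> x
    proof -
      have "claplace_beltrami ?S \<phi> x = l * \<phi> x"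
        using F that unfolding eigenfamily_def by simp
      then show ?thesis
        using claplace_beltrami_sphere[OF C[OF that(1)] that(2) s[of _ \<phi>, symmetric]] s[OF that(2), of \<phi>]
        by (simp only:)
    qed
    have harmonic: "\<exists>h. hpoly d h \<and> (\<forall>x. laplacian h x = 0) \<and> (\<forall>x. norm x = 1 \<longrightarrow> \<phi> x = h x)"
      if \<phi>: "\<phi> \<in> F" and l: "l = sphere_eigenvalue TYPE('n) d" for \<phi> d
    proof -
      obtain h where "hpoly d h" "\<And>x. laplacian h x = 0" "\<And>x. norm x = 1 \<Longrightarrow> \<phi> (sgn x) = h x"
        using eigenfunction_eq_harmonic[OF C[OF \<phi>] eig[OF \<phi>, unfolded l] n] by blast
      then show ?thesis using s[of _ \<phi>] by (intro exI[of _ h]) simp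
    qed
    \<comment> \<open>On the sphere the radial derivatives are \<open>d P\<close> and
      \<open>d Q\<close>, so the tangential condition with \<open>\<mu>\<close> becomes a flat one
      with \<open>\<mu> + d^2\<close>.\<close>
    have grad: "grad_prod P Q x = (\<mu> + (of_nat d)\<^sup>2) * (P x * Q x)"
      if "hpoly d P" "hpoly d Q" "\<phi> \<in> F" "\<psi> \<in> F" "norm x = 1"
        "\<And>x. norm x = 1 \<Longrightarrow> \<phi> x = P x" "\<And>x. norm x = 1 \<Longrightarrow> \<psi> x = Q x"
      for P Q \<phi> \<psi> x d
    proof -
      have "cmetric (cgradient ?S \<phi> x) (cgradient ?S \<psi> x) = \<mu> * \<phi> x * \<psi> x"
        using F that(3,4,5) unfolding eigenfamily_def by simp
      moreover have "cmetric (cgradient ?S \<phi> x) (cgradient ?S \<psi> x)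
          = grad_prod P Q x - radial_deriv P x * radial_deriv Q x"
        by (rule cmetric_cgradient_sphere[OF hpoly_differentiable[OF that(1)]
              hpoly_differentiable[OF that(2)] that(5,6,7)])
      ultimately show ?thesis
        using that(5,6,7) by (simp add: hpoly_radial_deriv[OF that(1)] hpoly_radial_deriv[OF that(2)]
            algebra_simps power2_eq_square)
    qed
    obtain d where d: "l = sphere_eigenvalue TYPE('n) d" "\<mu> = - (of_nat d)\<^sup>2"
    proof (cases "\<forall>\<phi>\<in>F. \<forall>x\<in>?S. \<phi> x = 0")
      case True
      then show ?thesis using assms(4) that ev by metis
    next
      case False
      then obtain \<phi> p where \<phi>: "\<phi> \<in> F" "norm p = 1" "\<phi> p \<noteq> 0" by auto
      obtain d where d: "l = sphere_eigenvalue TYPE('n) d"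
        using eigenvalue_of_eigenfunction[OF C[OF \<phi>(1)] eig[OF \<phi>(1)] \<phi>(2)] \<phi>(3) s[OF \<phi>(2), of \<phi>] by auto
      obtain h where h: "hpoly d h" "\<And>x. laplacian h x = 0" "\<And>x. norm x = 1 \<Longrightarrow> \<phi> x = h x"
        using harmonic[OF \<phi>(1) d] by blast
      have "\<mu> = - (of_nat d)\<^sup>2"
        by (rule harmonic_eigenfunction_mu[OF h(1,2) _ \<phi>(2) _ n])
          (use grad[OF h(1,1) \<phi>(1,1) _ h(3,3)] \<phi> h(3) in \<open>simp_all add: power2_eq_square\<close>)
      with d show ?thesis by (rule that)
    qed
    \<comment> \<open>All harmonic extensions at once, which avoids choosing one for each member of
      \<open>F\<close>; homogeneity makes restriction injective on this set.\<close>
    define Ft where "Ft = {P. hpoly d P \<and> (\<forall>x. laplacian P x = 0) \<and> restrict P ?S \<in> F}"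
    have eqr: "restrict P ?S x = P x" if "norm x = 1" for P x
      using that by simp
    have "grad_prod P Q = (\<lambda>x. 0)" if PQ: "P \<in> Ft" "Q \<in> Ft" for P Q
    \<comment> \<open>The gradient product is itself homogeneous, so its vanishing spreads from the
      sphere to all of space.\<close>
    proof (rule hpoly_eq_on_sphere[OF hpoly_grad_prod hpoly_zero])
      show "hpoly d P" "hpoly d Q" using PQ by (simp_all add: Ft_def)
      then show "grad_prod P Q x = 0" if "norm x = 1" for x
        using grad[OF _ _ _ _ that, where P = P and Q = Q and d = d and \<phi> = "restrict P ?S"
            and \<psi> = "restrict Q ?S"] PQ d(2) by (simp add: Ft_def)
    qed
    then have "eigenfamily UNIV 0 0 Ft"
      unfolding eigenfamily_def
      by (auto simp: Ft_def claplace_beltrami_UNIV[OF hpoly_Ck_on] hpoly_differentiable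
          cmetric_cgradient_UNIV intro: smooth_map_on_hpoly)
    moreover have "bij_betw (\<lambda>P. restrict P ?S) Ft F"
    proof (rule bij_betwI')
      fix P Q assume PQ: "P \<in> Ft" "Q \<in> Ft"
      show "(restrict P ?S = restrict Q ?S) = (P = Q)"
      proof
        assume e: "restrict P ?S = restrict Q ?S"
        show "P = Q"
          by (rule hpoly_eq_on_sphere[of d]) (use PQ eqr e in \<open>simp_all add: Ft_def, metis\<close>)
      qed simp
    next
      fix P assume "P \<in> Ft"
      then show "restrict P ?S \<in> F" by (simp add: Ft_def)
    next
      fix \<phi> assume \<phi>: "\<phi> \<in> F"
      obtain h where h: "hpoly d h" "\<forall>x. laplacian h x = 0" "\<And>x. norm x = 1 \<Longrightarrow> \<phi> x = h x"
        using harmonic[OF \<phi> d(1)] by blast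
      \<comment> \<open>Off the sphere both sides are \<open>undefined\<close>.\<close>
      have "\<phi> = restrict h ?S"
        by (rule extensionalityI[of _ ?S]) (use assms(3) \<phi> h(3) in auto)
      then show "\<exists>P\<in>Ft. \<phi> = restrict P ?S"
        using h \<phi> by (auto simp: Ft_def)
    qed
    moreover have "\<forall>P\<in>Ft. homogeneous_polynomial d P"
      by (simp add: Ft_def homogeneous_polynomial_iff_hpoly)
    ultimately show ?thesis
      using d ev by metis
  qed
  show "eigenfamily ?S l \<mu> F"
    if R: "\<exists>d Ft. eigenfamily (UNIV :: (real^'n) set) 0 0 Ft \<and>
       (\<forall>P\<in>Ft. homogeneous_polynomial d P) \<and>
       bij_betw (\<lambda>P. restrict P ?S) Ft F \<and>
       l = - (of_nat d * (of_nat d + of_nat m - 1)) \<and> \<mu> = - (of_nat d)\<^sup>2"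
  proof -
    obtain d Ft where E: "eigenfamily (UNIV :: (real^'n) set) 0 0 Ft"
      and hp: "\<And>P. P \<in> Ft \<Longrightarrow> hpoly d P" and bij: "bij_betw (\<lambda>P. restrict P ?S) Ft F"
      and l: "l = sphere_eigenvalue TYPE('n) d" and \<mu>: "\<mu> = - (of_nat d)\<^sup>2"
      using R unfolding homogeneous_polynomial_iff_hpoly ev by blast
    have lap: "laplacian P x = 0" if "P \<in> Ft" for P x
      using E that claplace_beltrami_UNIV[OF hpoly_Ck_on[OF hp[OF that]]] unfolding eigenfamily_def
      by simp
    have gp: "grad_prod P Q x = 0" if "P \<in> Ft" "Q \<in> Ft" for P Q x
      using E that unfolding eigenfamily_def
      by (simp add: cmetric_cgradient_UNIV hpoly_differentiable[OF hp])
    have ex: "\<exists>P\<in>Ft. \<forall>x. norm x = 1 \<longrightarrow> \<phi> x = P x" if "\<phi> \<in> F" for \<phi>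
      using bij_betw_imp_surj_on[OF bij] that by auto
    show ?thesis
      unfolding eigenfamily_def
    proof (intro conjI ballI)
      fix \<phi> assume "\<phi> \<in> F"
      then obtain P where P: "P \<in> Ft" "\<And>x. norm x = 1 \<Longrightarrow> \<phi> x = P x" using ex by blast
      show "smooth_map_on ?S \<phi>"
        by (rule smooth_map_on_hpoly[OF hp[OF P(1)]]) (simp add: P(2))
      fix x assume "x \<in> ?S"
      then have x: "norm x = 1" by simp
      have "claplace_beltrami ?S \<phi> x = sphere_laplacian P x"
        by (rule claplace_beltrami_sphere[OF hpoly_Ck_on_punctured[OF hp[OF P(1)]] x P(2)])
      then show "claplace_beltrami ?S \<phi> x = l * \<phi> x"
        unfolding hpoly_sphere_laplacian[OF hp[OF P(1)]] lap[OF P(1)] l P(2)[OF x] by simp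
    next
      fix \<phi> \<psi> x assume "\<phi> \<in> F" "\<psi> \<in> F" "x \<in> ?S"
      then obtain P Q where P: "P \<in> Ft" "\<And>x. norm x = 1 \<Longrightarrow> \<phi> x = P x"
        and Q: "Q \<in> Ft" "\<And>x. norm x = 1 \<Longrightarrow> \<psi> x = Q x" and x: "norm x = 1"
        using ex by (metis mem_sphere_0)
      have "cmetric (cgradient ?S \<phi> x) (cgradient ?S \<psi> x)
          = grad_prod P Q x - radial_deriv P x * radial_deriv Q x"
        by (rule cmetric_cgradient_sphere[OF hpoly_differentiable[OF hp[OF P(1)]]
            hpoly_differentiable[OF hp[OF Q(1)]] x P(2) Q(2)])
      then show "cmetric (cgradient ?S \<phi> x) (cgradient ?S \<psi> x) = \<mu> * \<phi> x * \<psi> x"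
        unfolding gp[OF P(1) Q(1)] hpoly_radial_deriv[OF hp[OF P(1)]] hpoly_radial_deriv[OF hp[OF Q(1)]]
          P(2)[OF x] Q(2)[OF x] \<mu> by (simp add: power2_eq_square)
    qed
  qed
qed

end
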